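(* Let $\mathbf{A}$ be an $n\times n$ Hermitian matrix, $\mathbf{b}\in\mathbb{C}^n$ a nonzero vector, and let $\mathbf{Q}_k,\mathbf{T}_k$ be the output of the Lanczos algorithm run on $(\mathbf{A},\mathbf{b})$ for $k$ steps. Let $f:\mathbb{C}\to\mathbb{C}$ be analytic in a neighborhood of the eigenvalues of $\mathbf{A}$ and $\mathbf{T}_k$, let $\Gamma$ be a simple closed curve, or a union of simple closed curves, inside this neighborhood and enclosing the eigenvalues of $\mathbf{A}$ and $\mathbf{T}_k$, and let $w\in\mathbb{R}$ with $w\notin\Lambda(\mathbf{T}_k)\cup\Lambda(\mathbf{A})$. Suppose that $S_0,S_1,\dots,S_k\subset\mathbb{R}$ satisfy $\Lambda(\mathbf{A})\subset S_0$ and $\lambda_i(\mathbf{T}_k)\in S_i$ for $i=1,\dots,k$. Then $$\left|\mathbf{b}^{\mathsf H}f(\mathbf{A})\mathbf{b}-\mathbf{b}^{\mathsf H}\mathsf{lan}_k(f)\right|\le\left(\frac{1}{2\pi}\oint_\Gamma|f(z)|\cdot\Big(\prod_{i=1}^k\|h_{w,z}\|_{S_i}^2\Big)\cdot\|h_z\|_{S_0}\,|\mathrm{d}z|\right)\|\mathsf{res}_k(w)\|_2^2 .$$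
   Context: Lanczos algorithm (exact arithmetic): given Hermitian $\mathbf{A}$ and $\mathbf{b}\neq 0$, set $\mathbf{q}_0=0$, $\beta_0=0$, $\mathbf{q}_1=\mathbf{b}/\|\mathbf{b}\|_2$, and for $j=1,\dots,k$: $\tilde{\mathbf{q}}=\mathbf{A}\mathbf{q}_j-\beta_{j-1}\mathbf{q}_{j-1}$, $\alpha_j=\langle\tilde{\mathbf{q}},\mathbf{q}_j\rangle$, $\tilde{\mathbf{q}}_{j+1}=\tilde{\mathbf{q}}-\alpha_j\mathbf{q}_j$, $\beta_j=\|\tilde{\mathbf{q}}_{j+1}\|_2$, $\mathbf{q}_{j+1}=\tilde{\mathbf{q}}_{j+1}/\beta_j$ (it is assumed that the algorithm does not break down, i.e. the divisions needed to produce $\mathbf{q}_1,\dots,\mathbf{q}_k$ are by nonzero numbers). The output is $\mathbf{Q}_k=[\mathbf{q}_1,\dots,\mathbf{q}_k]$, which has orthonormal columns, and the real symmetric tridiagonal $k\times k$ matrix $\mathbf{T}_k$ with diagonal $\alpha_1,\dots,\alpha_k$ and off-diagonal $\beta_1,\dots,\beta_{k-1}$; they satisfy $\mathbf{A}\mathbf{Q}_k=\mathbf{Q}_k\mathbf{T}_k+\beta_k\mathbf{q}_{k+1}\mathbf{e}_k^{\mathsf T}$. $\mathsf{lan}_k(f):=\mathbf{Q}_k f(\mathbf{T}_k)\mathbf{Q}_k^{\mathsf H}\mathbf{b}$, and $\mathsf{res}_k(w):=\mathbf{b}-(\mathbf{A}-w\mathbf{I})\mathbf{Q}_k(\mathbf{T}_k-w\mathbf{I})^{-1}\mathbf{Q}_k^{\mathsf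 H}\mathbf{b}$. For $w,z\in\mathbb{C}$, $h_{w,z}(x):=\frac{x-w}{x-z}$ and $h_z(x):=\frac{1}{x-z}$; for $S\subset\mathbb{R}$, $\|h\|_S:=\sup_{x\in S}|h(x)|$ (possibly $+\infty$). $\Lambda(\mathbf{B})$ is the set of eigenvalues of $\mathbf{B}$, and $\lambda_1(\mathbf{T}_k),\dots,\lambda_k(\mathbf{T}_k)$ are the eigenvalues of $\mathbf{T}_k$. Matrix functions of Hermitian matrices are defined through the eigendecomposition. "$\Gamma$ inside the neighborhood" is meant as in the Cauchy integral formula: $\Gamma$ and the regions it bounds lie in the neighborhood where $f$ is analytic, the curves are (piecewise smooth and) such that each eigenvalue is enclosed exactly once. *)

theory Defs
  imports
    "HOL-Complex_Analysis.Complex_Analysis"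
    "Jordan_Normal_Form.Gauss_Jordan_Elimination"
    "Jordan_Normal_Form.Schur_Decomposition"
    "Jordan_Normal_Form.Spectral_Radius"
begin

hide_const (open) Finite_Cartesian_Product.mat Finite_Cartesian_Product.vec
hide_type (open) Finite_Cartesian_Product.vec
no_notation Finite_Cartesian_Product.vec_nth (infixl \<open>$\<close> 90)

definition vnorm :: "complex vec \<Rightarrow> real" where
  "vnorm v = L2_set (\<lambda>i. cmod (v $ i)) {..<dim_vec v}"

text \<open>The Lanczos recurrence in exact arithmetic. Here \<open>lanczos_qt A b j\<close> is the unnormalised
  vector \<open>\<tilde>q\<^sub>j\<^sub>+\<^sub>1\<close> computed in step \<open>j\<close>, so that \<open>\<beta>\<^sub>j = \<parallel>\<tilde>q\<^sub>j\<^sub>+\<^sub>1\<parallel>\<close>.\<close>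

function (sequential)
      lanczos_q :: "complex mat \<Rightarrow> complex vec \<Rightarrow> nat \<Rightarrow> complex vec"
  and lanczos_beta :: "complex mat \<Rightarrow> complex vec \<Rightarrow> nat \<Rightarrow> real"
  and lanczos_alpha :: "complex mat \<Rightarrow> complex vec \<Rightarrow> nat \<Rightarrow> complex"
  and lanczos_qt :: "complex mat \<Rightarrow> complex vec \<Rightarrow> nat \<Rightarrow> complex vec"
where
  "lanczos_q A b 0 = 0\<^sub>v (dim_vec b)"
| "lanczos_q A b (Suc 0) = complex_of_real (1 / vnorm b) \<cdot>\<^sub>v b"
| "lanczos_q A b (Suc (Suc j)) =
     complex_of_real (1 / lanczos_beta A b (Suc j)) \<cdot>\<^sub>v lanczos_qt A b (Suc j)"
| "lanczos_beta A b 0 = 0"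
| "lanczos_beta A b (Suc j) = vnorm (lanczos_qt A b (Suc j))"
| "lanczos_alpha A b j =
     (A *\<^sub>v lanczos_q A b j - complex_of_real (lanczos_beta A b (j - 1)) \<cdot>\<^sub>v lanczos_q A b (j - 1))
       \<bullet>c lanczos_q A b j"
| "lanczos_qt A b j =
     (A *\<^sub>v lanczos_q A b j - complex_of_real (lanczos_beta A b (j - 1)) \<cdot>\<^sub>v lanczos_q A b (j - 1))
       - lanczos_alpha A b j \<cdot>\<^sub>v lanczos_q A b j"
  by pat_completeness auto
termination
  by (relation "Wellfounded.measure (\<lambda>x. case x of
         Inl (Inl (_, _, j)) \<Rightarrow> 4 * j
       | Inl (Inr (_, _, j)) \<Rightarrow> (if j = 0 then 0 else 4 * j + 3)
       | Inr (Inl (_, _, j)) \<Rightarrow> 4 * j + 1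
       | Inr (Inr (_, _, j)) \<Rightarrow> 4 * j + 2)") auto

definition lanczos_Q :: "complex mat \<Rightarrow> complex vec \<Rightarrow> nat \<Rightarrow> complex mat" where
  "lanczos_Q A b k = mat_of_cols (dim_vec b) (map (lanczos_q A b) [1..<k + 1])"

text \<open>Rows and columns of \<^typ>\<open>complex mat\<close> are numbered from \<open>0\<close>, the coefficients
  \<open>\<alpha>\<^sub>j\<close>, \<open>\<beta>\<^sub>j\<close> from \<open>1\<close>.\<close>

definition lanczos_T :: "complex mat \<Rightarrow> complex vec \<Rightarrow> nat \<Rightarrow> complex mat" where
  "lanczos_T A b k = Matrix.mat k k (\<lambda>(i, j).
     if i = j then lanczos_alpha A b (i + 1)
     else if j = i + 1 then complex_of_real (lanczos_beta A b (i + 1))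
     else if i = j + 1 then complex_of_real (lanczos_beta A b (j + 1))
     else 0)"

text \<open>\<open>f(A) = U diag(f(d\<^sub>0), \<dots>, f(d\<^sub>n\<^sub>-\<^sub>1)) U\<^sup>H\<close> for any unitary eigendecomposition
  \<open>A = U diag(d\<^sub>0, \<dots>, d\<^sub>n\<^sub>-\<^sub>1) U\<^sup>H\<close> of the Hermitian matrix \<open>A\<close>; the result does
  not depend on the decomposition.\<close>

definition hermitian_fun :: "(complex \<Rightarrow> complex) \<Rightarrow> complex mat \<Rightarrow> complex mat" where
  "hermitian_fun f A = (THE B. \<exists>U d. let n = dim_row A in
     U \<in> carrier_mat n n \<and> mat_adjoint U * U = 1\<^sub>m n \<and> U * mat_adjoint U = 1\<^sub>m n \<and>
     A = U * mat_diag n (\<lambda>i. complex_of_real (d i)) * mat_adjoint U \<and>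
     B = U * mat_diag n (\<lambda>i. f (complex_of_real (d i))) * mat_adjoint U)"

definition lan :: "complex mat \<Rightarrow> complex vec \<Rightarrow> nat \<Rightarrow> (complex \<Rightarrow> complex) \<Rightarrow> complex vec" where
  "lan A b k f =
     lanczos_Q A b k * hermitian_fun f (lanczos_T A b k) * mat_adjoint (lanczos_Q A b k) *\<^sub>v b"

definition shift_mat :: "complex mat \<Rightarrow> complex \<Rightarrow> complex mat" where
  "shift_mat A w = A - w \<cdot>\<^sub>m 1\<^sub>m (dim_row A)"

definition lanczos_res :: "complex mat \<Rightarrow> complex vec \<Rightarrow> nat \<Rightarrow> complex \<Rightarrow> complex vec" where
  "lanczos_res A b k w =
     b - shift_mat A w * lanczos_Q A b k * the (mat_inverse (shift_mat (lanczos_T A b k) w))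
           * mat_adjoint (lanczos_Q A b k) *\<^sub>v b"

text \<open>The sup norms \<open>\<parallel>h\<^sub>w\<^sub>,\<^sub>z\<parallel>\<^sub>S\<close> and \<open>\<parallel>h\<^sub>z\<parallel>\<^sub>S\<close>. They take the value \<open>\<infinity>\<close> when the function is
  unbounded on \<open>S\<close>. The division is that of \<^typ>\<open>ennreal\<close>, so a pole at a point of \<open>S\<close> also
  gives \<open>\<infinity>\<close> (division in \<^typ>\<open>complex\<close> would give \<open>0\<close> there).\<close>

definition norm_hwz :: "complex \<Rightarrow> complex \<Rightarrow> real set \<Rightarrow> ennreal" where
  "norm_hwz w z S =
     (SUP x\<in>S. ennreal (cmod (complex_of_real x - w)) / ennreal (cmod (complex_of_real x - z)))"

definition norm_hz :: "complex \<Rightarrow> real set \<Rightarrow> ennreal" where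
  "norm_hz z S = (SUP x\<in>S. 1 / ennreal (cmod (complex_of_real x - z)))"

text \<open>\<open>\<integral>\<^sub>\<gamma> F(z) |dz|\<close>\<close>

definition arclength_integral :: "(real \<Rightarrow> complex) \<Rightarrow> (complex \<Rightarrow> ennreal) \<Rightarrow> ennreal" where
  "arclength_integral \<gamma> F =
     (\<integral>\<^sup>+ t\<in>{0..1}. F (\<gamma> t) * ennreal (cmod (vector_derivative \<gamma> (at t within {0..1}))) \<partial>lborel)"

text \<open>The finitely many piecewise \<open>C\<^sup>1\<close> simple closed curves \<open>\<Gamma> 0, \<dots>, \<Gamma> (m - 1)\<close> and the regions
  they bound lie in \<open>D\<close>, none of the curves meets \<open>E\<close>, and each point of \<open>E\<close> is enclosed by exactly
  one of them. Orientations are left free, because the contour only enters through \<open>|dz|\<close>.\<close>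

definition encloses_once_in ::
    "complex set \<Rightarrow> nat \<Rightarrow> (nat \<Rightarrow> real \<Rightarrow> complex) \<Rightarrow> complex set \<Rightarrow> bool" where
  "encloses_once_in D m \<Gamma> E \<longleftrightarrow>
     (\<forall>j<m. valid_path (\<Gamma> j) \<and> simple_path (\<Gamma> j) \<and> pathfinish (\<Gamma> j) = pathstart (\<Gamma> j) \<and>
            path_image (\<Gamma> j) \<subseteq> D \<and> inside (path_image (\<Gamma> j)) \<subseteq> D \<and> path_image (\<Gamma> j) \<inter> E = {}) \<and>
     (\<forall>z\<in>E. \<exists>!j. j < m \<and> z \<in> inside (path_image (\<Gamma> j)))"

end

theory Submission
  imports Defs
begin

text \<open>In eigenbases of \<open>A\<close> and \<open>T\<^sub>k\<close> the error is a weighted sum \<open>\<Sum>\<^sub>i c\<^sub>i f(p\<^sub>i)\<close> over eigenvalues \<open>p\<^sub>i\<close>,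
  so Cauchy's formula reduces the claim to a bound on \<open>E(z) = \<Sum>\<^sub>i c\<^sub>i / (p\<^sub>i - z)\<close> for \<open>z\<close> on the contour.
  With \<open>r = \<tilde>q\<^sub>k\<^sub>+\<^sub>1\<close> the Lanczos relation gives \<open>res\<^sub>k(z) = - y\<^sub>k(z) r\<close>, where \<open>(T\<^sub>k - z) y(z) = Q\<^sup>H b\<close>.
  By Cramer's rule \<open>y\<^sub>k(z) det (T\<^sub>k - z)\<close> is \<open>\<parallel>b\<parallel>\<close> times a cofactor that does not depend on \<open>z\<close>, hence
  \<open>res\<^sub>k(z) = (\<Prod>\<^sub>i h\<^sub>w\<^sub>,\<^sub>z(\<lambda>\<^sub>i)) res\<^sub>k(w)\<close>. Since \<open>Q\<^sup>H r = 0\<close>, the error \<open>(A - z)\<^sup>-\<^sup>1 res\<^sub>k(z)\<close> of the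
  linear system may be tested against \<open>res\<^sub>k(z*)\<close> (\<open>z*\<close> the conjugate of \<open>z\<close>) instead of \<open>b\<close>, so that
  \<open>E(z) = \<langle>(A - z)\<^sup>-\<^sup>1 res\<^sub>k(z), res\<^sub>k(z*)\<rangle>\<close>: this is why the product enters squared.\<close>

no_notation fps_nth (infixl \<open>$\<close> 75)

section \<open>Cauchy's formula and arc length\<close>

text \<open>Contour integrals are gauge integrals, which need not converge absolutely. If the right
  side is infinite nothing is claimed; otherwise \<open>h\<close>, cut off outside \<open>X\<close>,
  is Lebesgue integrable, and both integrals agree.\<close>

lemma norm_has_integral_le_nn_integral:
  fixes h :: "'a::euclidean_space \<Rightarrow> 'b::euclidean_space"
  assumes h: "(h has_integral I) X"
  shows "ennreal (norm I) \<le> (\<integral>\<^sup>+ t\<in>X. ennreal (norm (h t)) \<partial>lborel)"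
proof (cases "(\<integral>\<^sup>+ t\<in>X. ennreal (norm (h t)) \<partial>lborel) = \<infinity>")
  case False
  define g where "g = (\<lambda>x. indicator X x *\<^sub>R h x)"
  have g_nn: "(\<integral>\<^sup>+ t. ennreal (norm (g t)) \<partial>lebesgue) = (\<integral>\<^sup>+ t\<in>X. ennreal (norm (h t)) \<partial>lborel)"
    unfolding nn_integral_completion g_def
    by (intro nn_integral_cong) (auto split: split_indicator)
  have "integrable lebesgue g"
    using has_integral_implies_lebesgue_measurable[OF h] False g_nn
    by (intro integrableI_bounded) (auto simp: g_def top.not_eq_extremum)
  moreover have "(g has_integral I) UNIV"
    using h unfolding has_integral_restrict_UNIV[of X h, symmetric] g_def
    by (rule has_integral_eq[rotated]) auto
  ultimately have "I = integral\<^sup>L lebesgue g"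
    using has_integral_integral_lebesgue has_integral_unique by blast
  with \<open>integrable lebesgue g\<close> show ?thesis
    using integral_norm_bound_ennreal g_nn by metis
qed simp

text \<open>Stated without measurability of \<open>F\<close>, because the sup norms over arbitrary sets \<open>S\<^sub>i\<close> occur in
  the integrand.\<close>

lemma nn_integral_cmult_le:
  assumes "c \<noteq> (\<infinity>::ennreal)"
  shows "(\<integral>\<^sup>+ x. c * F x \<partial>M) \<le> c * (\<integral>\<^sup>+ x. F x \<partial>M)"
proof (cases "c = 0")
  case False
  show ?thesis
    \<comment> \<open>Only the left integral is opened as a supremum over simple functions. For a
      simple \<open>g\<close> below \<open>c * F\<close>, the quotient \<open>g / c\<close> is
      measurable and below \<open>F\<close>, so the constant can be moved out of its
      integral.\<close>
    unfolding nn_integral_def[of M "\<lambda>x. c * F x"]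
  proof (rule SUP_least, clarify)
    fix g assume g: "simple_function M g" "g \<le> (\<lambda>x. c * F x)"
    have cg: "c * (g x / c) = g x" for x
      unfolding ennreal_times_divide mult.commute[of c]
      by (rule ennreal_mult_divide_eq) (use False assms in auto)
    have "g x / c \<le> F x" for x
      using g(2) False by (intro divide_le_posI_ennreal) (auto simp: le_fun_def zero_less_iff_neq_zero)
    then have le: "(\<integral>\<^sup>+ x. g x / c \<partial>M) \<le> (\<integral>\<^sup>+ x. F x \<partial>M)"
      by (intro nn_integral_mono)
    have [measurable]: "g \<in> borel_measurable M"
      using g(1) by (rule borel_measurable_simple_function)
    have "integral\<^sup>S M g = (\<integral>\<^sup>+ x. c * (g x / c) \<partial>M)"
      using g(1) by (simp add: cg nn_integral_eq_simple_integral)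
    also have "\<dots> = c * (\<integral>\<^sup>+ x. g x / c \<partial>M)"
      by (intro nn_integral_cmult) measurable
    also have "\<dots> \<le> c * (\<integral>\<^sup>+ x. F x \<partial>M)"
      using le by (rule mult_left_mono) simp
    finally show "integral\<^sup>S M g \<le> c * (\<integral>\<^sup>+ x. F x \<partial>M)" .
  qed
qed simp

lemma arclength_integral_le_mult:
  assumes "\<And>z. z \<in> path_image \<gamma> \<Longrightarrow> G z \<le> c * F z" and "c \<noteq> (\<infinity>::ennreal)"
  shows "arclength_integral \<gamma> G \<le> c * arclength_integral \<gamma> F"
proof -
  have "G (\<gamma> t) \<le> c * F (\<gamma> t)" if "t \<in> {0..1}" for t
    using assms(1) that by (auto simp: path_image_def)
  then have "arclength_integral \<gamma> G \<le> (\<integral>\<^sup>+ t. c * (F (\<gamma> t) *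
      ennreal (cmod (vector_derivative \<gamma> (at t within {0..1}))) * indicator {0..1} t) \<partial>lborel)"
    unfolding arclength_integral_def
    by (intro nn_integral_mono)
       (auto simp: mult.assoc[symmetric] intro!: mult_right_mono split: split_indicator)
  also have "\<dots> \<le> c * arclength_integral \<gamma> F"
    unfolding arclength_integral_def by (rule nn_integral_cmult_le[OF assms(2)])
  finally show ?thesis .
qed

text \<open>\<open>has_contour_integral\<close> and \<open>arclength_integral\<close> use the same
  derivative within \<open>{0..1}\<close>, so the integrands match pointwise, also at the corners of
  the path.\<close>

lemma has_contour_integral_norm_le_arclength:
  assumes "(g has_contour_integral I) \<gamma>"
  shows "ennreal (cmod I) \<le> arclength_integral \<gamma> (\<lambda>z. ennreal (cmod (g z)))"
  using norm_has_integral_le_nn_integral[OF assms[unfolded has_contour_integral_def]]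
  by (simp add: arclength_integral_def norm_mult ennreal_mult)

text \<open>The orientation of a contour is left free. The winding number of a simple closed curve
  is still constant on its inside, so a single sign \<open>s\<close> per curve records the
  orientation.\<close>

lemma simple_closed_path_winding_number_sign:
  assumes "simple_path \<gamma>" and "pathfinish \<gamma> = pathstart \<gamma>"
  obtains s :: complex where "s = 1 \<or> s = -1"
    and "\<And>z. z \<notin> path_image \<gamma> \<Longrightarrow>
      winding_number \<gamma> z = (if z \<in> inside (path_image \<gamma>) then s else 0)"
proof -
  have out: "winding_number \<gamma> z = 0" if "z \<notin> path_image \<gamma>" "z \<notin> inside (path_image \<gamma>)" for z
    using that assms by (intro winding_number_zero_in_outside)
      (auto simp: simple_path_imp_path inside_outside[of "path_image \<gamma>"])
  show thesis
    using simple_closed_path_winding_number_inside[OF assms(1)]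
  proof cases
    case 1 then show ?thesis using that[of 1] out assms(2) by auto
  next
    case 2 then show ?thesis using that[of "-1"] out assms(2) by auto
  qed
qed

text \<open>Cauchy's formula on each curve gives the terms of the points that it encloses, up to the
  sign of its orientation. Each point is enclosed once, so the signed sum over the curves recovers
  the whole sum, and the signs disappear under the modulus.\<close>

lemma cauchy_weighted_sum_bound:
  fixes c p :: "'i \<Rightarrow> complex"
  assumes D: "open D" "E \<subseteq> D" and f: "f analytic_on D" and enc: "encloses_once_in D m \<Gamma> E"
    and I: "finite I" "p ` I \<subseteq> E"
  shows "ennreal (cmod (\<Sum>i\<in>I. c i * f (p i)))
    \<le> ennreal (1 / (2 * pi)) *
      (\<Sum>j<m. arclength_integral (\<Gamma> j)
        (\<lambda>z. ennreal (cmod (f z) * cmod (\<Sum>i\<in>I. c i / (p i - z)))))"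
proof -
  have path: "valid_path (\<Gamma> j)" "simple_path (\<Gamma> j)" "pathfinish (\<Gamma> j) = pathstart (\<Gamma> j)"
    "path_image (\<Gamma> j) \<subseteq> D" "inside (path_image (\<Gamma> j)) \<subseteq> D" "path_image (\<Gamma> j) \<inter> E = {}"
    if "j < m" for j
    using enc that by (auto simp: encloses_once_in_def)
  have once: "\<exists>!j. j < m \<and> p i \<in> inside (path_image (\<Gamma> j))" if i: "i \<in> I" for i
    using enc I(2) imageI[OF that, of p] unfolding encloses_once_in_def by blast
  define isin where "isin j i = (if p i \<in> inside (path_image (\<Gamma> j)) then 1 else 0 :: complex)" for j i
  define R where "R z = (\<Sum>i\<in>I. c i / (p i - z))" for z
  have "\<exists>s. (s = 1 \<or> s = - 1) \<and> (\<forall>z. z \<notin> path_image (\<Gamma> j) \<longrightarrow>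
      winding_number (\<Gamma> j) z = (if z \<in> inside (path_image (\<Gamma> j)) then s else 0))"
    if "j < m" for j
    using simple_closed_path_winding_number_sign[OF path(2,3)[OF that]] by metis
  then obtain s :: "nat \<Rightarrow> complex" where s: "\<And>j. j < m \<Longrightarrow> s j = 1 \<or> s j = - 1"
    and wn: "\<And>j z. j < m \<Longrightarrow> z \<notin> path_image (\<Gamma> j) \<Longrightarrow>
      winding_number (\<Gamma> j) z = (if z \<in> inside (path_image (\<Gamma> j)) then s j else 0)"
    by metis
  \<comment> \<open>The minus sign comes from
    \<open>1 / (p i - z) = - 1 / (z - p i)\<close>.\<close>
  define J where "J j = (\<Sum>i\<in>I. - c i * (2 * pi * \<i> * (s j * isin j i) * f (p i)))" for j
  have J: "((\<lambda>z. f z * R z) has_contour_integral J j) (\<Gamma> j)" if j: "j < m" for j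
  proof -
    have "((\<lambda>z. f z / (z - p i)) has_contour_integral (2 * pi * \<i> * (s j * isin j i) * f (p i))) (\<Gamma> j)"
      if i: "i \<in> I" for i
    proof -
      have pi: "p i \<in> D" "p i \<notin> path_image (\<Gamma> j)" using I i D path[OF j] by auto
      \<comment> \<open>The homology condition of the global Cauchy formula: the curve and its
        inside both lie in \<open>D\<close>, so a point off \<open>D\<close> is outside the
        curve.\<close>
      have "winding_number (\<Gamma> j) z = 0" if "z \<notin> D" for z
        using wn[OF j, of z] that subsetD[OF path(4)[OF j], of z] subsetD[OF path(5)[OF j], of z]
        by metis
      from Cauchy_integral_formula_global[OF D(1) analytic_imp_holomorphic[OF f] pi(1) _ _ _ this]
      show ?thesis using path(1,3,4)[OF j] pi wn[OF j pi(2)]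
        by (cases "p i \<in> inside (path_image (\<Gamma> j))") (simp_all add: isin_def subset_Diff_insert)
    qed
    then have "((\<lambda>z. \<Sum>i\<in>I. - c i * (f z / (z - p i))) has_contour_integral J j) (\<Gamma> j)"
      unfolding J_def by (intro has_contour_integral_sum I has_contour_integral_lmul)
    moreover have "(\<lambda>z. \<Sum>i\<in>I. - c i * (f z / (z - p i))) = (\<lambda>z. f z * R z)"
      proof
      fix z
      have "- c i * (f z / (z - p i)) = f z * (c i / (p i - z))" for i
        by (metis (no_types) minus_diff_eq minus_divide_right mult.commute mult_minus_left
            mult_minus_right times_divide_eq_left)
      then show "(\<Sum>i\<in>I. - c i * (f z / (z - p i))) = f z * R z"
        by (simp add: R_def sum_distrib_left)
    qed
    ultimately show ?thesis by simp
  qed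
  have ss: "s j * s j = 1" if "j < m" for j using s[OF that] by auto
  \<comment> \<open>Here the enclosure of each point by exactly one curve enters.\<close>
  have one: "(\<Sum>j<m. isin j i) = 1" if i: "i \<in> I" for i
  proof -
    obtain j where j: "j < m \<and> p i \<in> inside (path_image (\<Gamma> j))"
      and u: "\<forall>j'. j' < m \<and> p i \<in> inside (path_image (\<Gamma> j')) \<longrightarrow> j' = j"
      using once[OF i] by (rule ex1E)
    have "(\<Sum>j<m. isin j i) = (\<Sum>j'<m. if j' = j then 1 else 0)"
    proof (rule sum.cong[OF refl])
      fix j' assume "j' \<in> {..<m}"
      then show "isin j' i = (if j' = j then 1 else 0)"
        unfolding isin_def using j spec[OF u, of j'] by (metis lessThan_iff)
    qed
    also have "\<dots> = 1" using j by simp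
    finally show ?thesis .
  qed
  \<comment> \<open>Multiplying by \<open>s j\<close> again undoes the orientation, since
    \<open>s j * s j = 1\<close>; the contributions of all curves then add up with the same
    sign.\<close>
  have "s j * J j = (\<Sum>i\<in>I. - (2 * pi * \<i>) * (c i * f (p i)) * isin j i)" if "j < m" for j
  proof -
    have "s j * J j = (s j * s j) * (\<Sum>i\<in>I. - (2 * pi * \<i>) * (c i * f (p i)) * isin j i)"
      unfolding J_def sum_distrib_left by (intro sum.cong) (simp_all add: algebra_simps)
    then show ?thesis using ss[OF that] by simp
  qed
  then have "(\<Sum>j<m. s j * J j) = (\<Sum>j<m. \<Sum>i\<in>I. - (2 * pi * \<i>) * (c i * f (p i)) * isin j i)"
    by simp
  also have "\<dots> = (\<Sum>i\<in>I. - (2 * pi * \<i>) * (c i * f (p i)) * (\<Sum>j<m. isin j i))"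
    by (subst sum.swap) (simp add: sum_distrib_left)
  also have "\<dots> = - (2 * pi * \<i>) * (\<Sum>i\<in>I. c i * f (p i))"
    by (simp add: one sum_distrib_left)
  finally have "cmod (\<Sum>j<m. s j * J j) = 2 * pi * cmod (\<Sum>i\<in>I. c i * f (p i))"
    by (simp add: norm_mult)
  moreover have "cmod (\<Sum>j<m. s j * J j) \<le> (\<Sum>j<m. cmod (J j))"
  proof (rule sum_norm_le)
    fix j assume "j \<in> {..<m}"
    then have "cmod (s j) = 1" using s[of j] by auto
    then show "cmod (s j * J j) \<le> cmod (J j)" by (simp add: norm_mult)
  qed
  ultimately have "cmod (\<Sum>i\<in>I. c i * f (p i)) \<le> 1 / (2 * pi) * (\<Sum>j<m. cmod (J j))"
    by (simp add: field_simps)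
  then have "ennreal (cmod (\<Sum>i\<in>I. c i * f (p i))) \<le> ennreal (1 / (2 * pi) * (\<Sum>j<m. cmod (J j)))"
    by (rule ennreal_leI)
  also have "\<dots> = ennreal (1 / (2 * pi)) * (\<Sum>j<m. ennreal (cmod (J j)))"
    by (subst ennreal_mult) (auto simp: sum_nonneg sum_ennreal)
  also have "\<dots> \<le> ennreal (1 / (2 * pi)) *
      (\<Sum>j<m. arclength_integral (\<Gamma> j) (\<lambda>z. ennreal (cmod (f z * R z))))"
    using J by (intro mult_left_mono sum_mono has_contour_integral_norm_le_arclength) auto
  finally show ?thesis by (simp add: R_def norm_mult)
qed

section \<open>The spectral theorem and functions of Hermitian matrices\<close>

lemma mat_adjoint_dim [simp]:
  "dim_row (mat_adjoint A) = dim_col A" "dim_col (mat_adjoint A) = dim_row A"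
  by (auto simp: mat_adjoint_def)

lemma mat_adjoint_carrier:
  "A \<in> carrier_mat m n \<Longrightarrow> mat_adjoint A \<in> carrier_mat n m"
  by (rule carrier_matI) auto

lemma mat_adjoint_index [simp]:
  fixes A :: "complex mat"
  assumes "i < dim_col A" and "j < dim_row A"
  shows "mat_adjoint A $$ (i, j) = cnj (A $$ (j, i))"
  using assms by (simp add: mat_adjoint_def mat_of_rows_def)

lemma mat_adjoint_adjoint [simp]: "mat_adjoint (mat_adjoint A) = (A :: complex mat)"
  by (rule eq_matI) auto

lemma mat_adjoint_mult:
  fixes A B :: "complex mat"
  assumes "A \<in> carrier_mat m n" and "B \<in> carrier_mat n p"
  shows "mat_adjoint (A * B) = mat_adjoint B * mat_adjoint A"
  by (rule eq_matI) (use assms in \<open>auto simp: scalar_prod_def mult.commute intro!: sum.cong\<close>)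

lemma mat_adjoint_four_block:
  fixes A B C D :: "complex mat"
  assumes "A \<in> carrier_mat nr1 nc1" "B \<in> carrier_mat nr1 nc2"
    "C \<in> carrier_mat nr2 nc1" "D \<in> carrier_mat nr2 nc2"
  shows "mat_adjoint (four_block_mat A B C D)
    = four_block_mat (mat_adjoint A) (mat_adjoint C) (mat_adjoint B) (mat_adjoint D)"
  by (rule eq_matI) (use assms in auto)

lemma cscalar_prod_adjoint:
  fixes A :: "complex mat"
  assumes A: "A \<in> carrier_mat m n" and x: "x \<in> carrier_vec n" and y: "y \<in> carrier_vec m"
  shows "(A *\<^sub>v x) \<bullet>c y = x \<bullet>c (mat_adjoint A *\<^sub>v y)"
proof -
  have "(A *\<^sub>v x) \<bullet>c y = (\<Sum>i<m. \<Sum>j<n. A $$ (i, j) * x $ j * cnj (y $ i))"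
    using assms by (simp add: scalar_prod_def sum_distrib_right lessThan_atLeast0)
  also have "\<dots> = (\<Sum>j<n. \<Sum>i<m. A $$ (i, j) * x $ j * cnj (y $ i))"
    by (rule sum.swap)
  also have "\<dots> = x \<bullet>c (mat_adjoint A *\<^sub>v y)"
    using assms by (simp add: scalar_prod_def sum_distrib_left lessThan_atLeast0 ac_simps)
  finally show ?thesis .
qed

lemma cscalar_prod_eq_sum:
  fixes x y :: "complex vec"
  assumes "y \<in> carrier_vec n"
  shows "x \<bullet>c y = (\<Sum>i<n. x $ i * cnj (y $ i))"
  using assms by (simp add: scalar_prod_def lessThan_atLeast0)

lemma cnj_cscalar_prod:
  fixes x y :: "complex vec"
  assumes "x \<in> carrier_vec n" and "y \<in> carrier_vec n"
  shows "cnj (x \<bullet>c y) = y \<bullet>c x"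
  using assms by (simp add: cscalar_prod_eq_sum mult.commute)

lemma vnorm_square: "complex_of_real ((vnorm v)\<^sup>2) = v \<bullet>c v"
  by (simp add: vnorm_def L2_set_def sum_nonneg scalar_prod_def complex_norm_square
      lessThan_atLeast0 del: of_real_power)

lemma vnorm_smult: "vnorm (c \<cdot>\<^sub>v v) = cmod c * vnorm v"
  by (simp add: vnorm_def L2_set_def norm_mult power_mult_distrib real_sqrt_mult
      flip: sum_distrib_left)

lemma vnorm_eq_0_iff: "v \<in> carrier_vec n \<Longrightarrow> vnorm v = 0 \<longleftrightarrow> v = 0\<^sub>v n"
  by (auto simp: vnorm_def L2_set_eq_0_iff)

lemma cscalar_prod_minus_left:
  fixes x y v :: "complex vec"
  assumes "x \<in> carrier_vec n" "y \<in> carrier_vec n" "v \<in> carrier_vec n"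
  shows "(x - y) \<bullet>c v = x \<bullet>c v - y \<bullet>c v"
  using assms by (simp add: cscalar_prod_eq_sum left_diff_distrib sum_subtractf)

lemma cscalar_prod_add_right:
  fixes x y v :: "complex vec"
  assumes "x \<in> carrier_vec n" "y \<in> carrier_vec n" "v \<in> carrier_vec n"
  shows "v \<bullet>c (x + y) = v \<bullet>c x + v \<bullet>c y"
  using assms by (simp add: cscalar_prod_eq_sum[of _ n] distrib_left sum.distrib)

lemma cscalar_prod_smult_left:
  fixes x v :: "complex vec"
  assumes "x \<in> carrier_vec n" "v \<in> carrier_vec n"
  shows "(c \<cdot>\<^sub>v x) \<bullet>c v = c * (x \<bullet>c v)"
  using assms by (simp add: cscalar_prod_eq_sum sum_distrib_left mult.assoc)

lemma cscalar_prod_smult_right: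
  fixes x v :: "complex vec"
  assumes "x \<in> carrier_vec n" "v \<in> carrier_vec n"
  shows "v \<bullet>c (c \<cdot>\<^sub>v x) = cnj c * (v \<bullet>c x)"
  using assms by (simp add: cscalar_prod_eq_sum[of _ n] sum_distrib_left ac_simps)

section \<open>Unitary diagonalization of Hermitian matrices\<close>

lemma unitary_completion:
  fixes v :: "complex vec"
  assumes v: "v \<in> carrier_vec n" "v \<noteq> 0\<^sub>v n"
  obtains W c where "W \<in> carrier_mat n n" "mat_adjoint W * W = 1\<^sub>m n" "W * mat_adjoint W = 1\<^sub>m n"
    "col W 0 = c \<cdot>\<^sub>v v"
proof -
  have n: "n \<noteq> 0" using v by auto
  \<comment> \<open>Completing \<open>v\<close> to a basis puts it in front, and Gram-Schmidt keeps
    the first vector. After normalization the first column is therefore a multiple of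
    \<open>v\<close>.\<close>
  define b where "b = basis_completion v"
  define ws where "ws = gram_schmidt n b"
  interpret cof_vec_space n "TYPE(complex)" .
  from basis_completion[OF v, folded b_def]
  have dist_b: "distinct b" and indep: "\<not> lin_dep (set b)" and b: "set b \<subseteq> carrier_vec n"
    and len_b: "length b = n" by auto
  have hdb: "hd b = v" by (simp add: b_def basis_completion_def Let_def)
  from hdb len_b n obtain vs where bv: "b = v # vs" by (cases b) auto
  from gram_schmidt_result[OF b dist_b indep refl, folded ws_def]
  have ws: "set ws \<subseteq> carrier_vec n" "corthogonal ws" "length ws = n"
    by (auto simp: len_b)
  from gram_schmidt_hd[OF v(1), of vs, folded bv] have "hd ws = v" unfolding ws_def .
  then have ws0: "ws ! 0 = v" using ws(3) n by (cases ws) auto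
  have wsj: "ws ! j \<in> carrier_vec n" if "j < n" for j using ws that by auto
  have orth: "ws ! i \<bullet>c ws ! j = 0 \<longleftrightarrow> i \<noteq> j" if "i < n" "j < n" for i j
    using corthogonalD[OF ws(2)] ws(3) that by auto
  define N where "N j = complex_of_real (vnorm (ws ! j))" for j
  have N2: "N j * N j = ws ! j \<bullet>c ws ! j" for j
    using vnorm_square[of "ws ! j"] by (simp add: N_def power2_eq_square)
  have N0: "N j \<noteq> 0" if "j < n" for j
    using N2[of j] orth[OF that that] by auto
  define W where "W = Matrix.mat n n (\<lambda>(i, j). (ws ! j) $ i / N j)"
  have W: "W \<in> carrier_mat n n" by (simp add: W_def)
  have WW: "mat_adjoint W * W = 1\<^sub>m n"
  proof (rule eq_matI)
    fix i j assume "i < dim_row (1\<^sub>m n :: complex mat)" "j < dim_col (1\<^sub>m n :: complex mat)"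
    then have ij: "i < n" "j < n" by auto
    have "(mat_adjoint W * W) $$ (i, j) = (\<Sum>l<n. cnj (ws ! i $ l / N i) * (ws ! j $ l / N j))"
      using ij by (simp add: W_def scalar_prod_def lessThan_atLeast0)
    also have "\<dots> = (ws ! j \<bullet>c ws ! i) / (N i * N j)"
      using wsj[OF ij(1)]
      by (simp add: cscalar_prod_eq_sum sum_divide_distrib N_def mult.commute)
    also have "\<dots> = (if i = j then 1 else 0)"
      using orth[OF ij(2) ij(1)] N2[of i] N0[OF ij(1)]
      by (cases "i = j") auto
    finally show "(mat_adjoint W * W) $$ (i, j) = 1\<^sub>m n $$ (i, j)" using ij by simp
  qed (auto simp: W_def)
  show thesis
  proof (rule that[OF W WW])
    show "W * mat_adjoint W = 1\<^sub>m n"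
      by (rule mat_mult_left_right_inverse[OF mat_adjoint_carrier[OF W] W WW])
    show "col W 0 = (1 / N 0) \<cdot>\<^sub>v v"
      by (rule eq_vecI) (use n v ws0 in \<open>auto simp: W_def\<close>)
  qed
qed

text \<open>The block diagonal matrix \<open>diag(c, M)\<close>. It carries the decomposition of the
  deflated matrix of size \<open>n\<close> over to size \<open>n + 1\<close>.\<close>

definition corner_block :: "nat \<Rightarrow> complex \<Rightarrow> complex mat \<Rightarrow> complex mat" where
  "corner_block n c M = four_block_mat (Matrix.mat 1 1 (\<lambda>_. c)) (0\<^sub>m 1 n) (0\<^sub>m n 1) M"

lemma corner_block_carrier [simp]:
  "M \<in> carrier_mat n n \<Longrightarrow> corner_block n c M \<in> carrier_mat (Suc n) (Suc n)"
  unfolding corner_block_def using four_block_carrier_mat[of _ 1 1 M n n] by auto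

lemma corner_block_mult:
  assumes "M \<in> carrier_mat n n" and "N \<in> carrier_mat n n"
  shows "corner_block n c M * corner_block n d N = corner_block n (c * d) (M * N)"
proof -
  have "Matrix.mat 1 1 (\<lambda>_. c) * Matrix.mat 1 1 (\<lambda>_. d) = Matrix.mat 1 1 (\<lambda>_. c * d)"
    by (rule eq_matI) (auto simp: scalar_prod_def)
  then show ?thesis
    unfolding corner_block_def using assms
    by (subst mult_four_block_mat[of _ 1 1 _ n _ n _ _ 1 _ n]) auto
qed

lemma corner_block_adjoint:
  assumes "M \<in> carrier_mat n n"
  shows "mat_adjoint (corner_block n c M) = corner_block n (cnj c) (mat_adjoint M)"
proof -
  have "mat_adjoint (Matrix.mat 1 1 (\<lambda>_. c)) = Matrix.mat 1 1 (\<lambda>_. cnj c)"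
    "mat_adjoint (0\<^sub>m 1 n) = (0\<^sub>m n 1 :: complex mat)"
    "mat_adjoint (0\<^sub>m n 1) = (0\<^sub>m 1 n :: complex mat)"
    by (rule eq_matI; auto)+
  then show ?thesis
    unfolding corner_block_def using assms
    by (subst mat_adjoint_four_block[of _ 1 1 _ n _ n]) auto
qed

lemma corner_block_one: "corner_block n 1 (1\<^sub>m n) = 1\<^sub>m (Suc n)"
proof -
  have "Matrix.mat 1 1 (\<lambda>_. 1) = (1\<^sub>m 1 :: complex mat)" by (rule eq_matI) auto
  then show ?thesis unfolding corner_block_def using four_block_one_mat[of 1 n] by simp
qed

lemma corner_block_diag:
  "corner_block n (f 0) (mat_diag n (\<lambda>i. f (Suc i))) = mat_diag (Suc n) f"
  by (rule eq_matI) (auto simp: corner_block_def mat_diag_def)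

text \<open>Induction by deflation. In an orthonormal basis that begins with an eigenvector the
  first column is a multiple of the first unit vector; by symmetry the first row is too, and the
  remaining block is again Hermitian.\<close>

lemma hermitian_spectral_decomposition:
  fixes A :: "complex mat"
  assumes "A \<in> carrier_mat n n" and "mat_adjoint A = A"
  shows "\<exists>U d. U \<in> carrier_mat n n \<and> mat_adjoint U * U = 1\<^sub>m n \<and> U * mat_adjoint U = 1\<^sub>m n \<and>
    A = U * mat_diag n (\<lambda>i. complex_of_real (d i)) * mat_adjoint U"
  using assms
proof (induction n arbitrary: A)
  case 0
  then show ?case by (intro exI[of _ "1\<^sub>m 0"] exI) auto
next
  case (Suc n)
  note A = Suc.prems(1)
  from spectrum_non_empty[OF A] obtain e v where "eigenvector A v e"
    by (auto simp: spectrum_def eigenvalue_def)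
  then have v: "v \<in> carrier_vec (Suc n)" "v \<noteq> 0\<^sub>v (Suc n)" and Av: "A *\<^sub>v v = e \<cdot>\<^sub>v v"
    using A by (auto simp: eigenvector_def)
  obtain W c where W: "W \<in> carrier_mat (Suc n) (Suc n)" and WW: "mat_adjoint W * W = 1\<^sub>m (Suc n)"
    "W * mat_adjoint W = 1\<^sub>m (Suc n)" and W0: "col W 0 = c \<cdot>\<^sub>v v"
    using unitary_completion[OF v] .
  note W' = mat_adjoint_carrier[OF W]
  have cW0: "col W 0 \<in> carrier_vec (Suc n)" using col_carrier_vec[OF _ W, of 0] by simp
  define B where "B = mat_adjoint W * A * W"
  have B: "B \<in> carrier_mat (Suc n) (Suc n)" using W W' A by (simp add: B_def)
  have AWBW: "A = W * B * mat_adjoint W"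
  proof -
    have "W * B * mat_adjoint W = (W * mat_adjoint W) * A * (W * mat_adjoint W)"
      unfolding B_def using W W' A by (simp add: assoc_mult_mat[of _ "Suc n" "Suc n" _ "Suc n" _ "Suc n"])
    then show ?thesis using A by (simp add: WW)
  qed
  have Bh: "mat_adjoint B = B"
    unfolding B_def using W W' A Suc.prems(2)
    by (simp add: mat_adjoint_mult[of _ "Suc n" "Suc n" _ "Suc n"]
        assoc_mult_mat[of _ "Suc n" "Suc n" _ "Suc n" _ "Suc n"])
  \<comment> \<open>The first column of \<open>W\<close> is parallel to the eigenvector, so
    \<open>A\<close> scales it by \<open>e\<close> and the adjoint of \<open>W\<close> sends it to
    the first unit vector.\<close>
  have "col B 0 = mat_adjoint W * A *\<^sub>v col W 0"
    unfolding B_def by (rule col_mult2[of _ "Suc n" "Suc n" _ "Suc n"]) (use W W' A in auto)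
  also have "\<dots> = mat_adjoint W *\<^sub>v (A *\<^sub>v col W 0)"
    by (rule assoc_mult_mat_vec[of _ "Suc n" "Suc n" _ "Suc n"]) (use W W' A cW0 in auto)
  also have "A *\<^sub>v col W 0 = e \<cdot>\<^sub>v col W 0"
    unfolding W0 using A v Av by (simp add: mult_mat_vec smult_smult_assoc mult.commute)
  also have "mat_adjoint W *\<^sub>v (e \<cdot>\<^sub>v col W 0) = e \<cdot>\<^sub>v col (mat_adjoint W * W) 0"
    using W W' col_mult2[OF W' W, of 0]
    by (subst mult_mat_vec[of _ "Suc n" "Suc n"]) (auto simp: cW0)
  also have "\<dots> = e \<cdot>\<^sub>v unit_vec (Suc n) 0" by (simp add: WW)
  finally have "col B 0 $ i = (if i = 0 then e else 0)" if "i < Suc n" for i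
    using that by simp
  then have B0: "B $$ (i, 0) = (if i = 0 then e else 0)" if "i < Suc n" for i
    using that B by simp
  \<comment> \<open>Symmetry clears the first row of \<open>B\<close> and, at the corner, shows that
    \<open>e\<close> is real.\<close>
  have B0': "B $$ (0, i) = cnj (B $$ (i, 0))" if "i < Suc n" for i
    using arg_cong[OF Bh, of "\<lambda>M. M $$ (0, i)"] that B by simp
  have e_cnj: "cnj e = e" using B0'[of 0] B0[of 0] by simp
  then have e: "e = complex_of_real (Re e)" by (simp add: complex_eq_iff)
  define B' where "B' = Matrix.mat n n (\<lambda>(i, j). B $$ (Suc i, Suc j))"
  have B': "B' \<in> carrier_mat n n" by (simp add: B'_def)
  have "mat_adjoint B' = B'"
  proof (rule eq_matI)
    fix i j assume "i < dim_row B'" "j < dim_col B'"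
    then show "mat_adjoint B' $$ (i, j) = B' $$ (i, j)"
      using arg_cong[OF Bh, of "\<lambda>M. M $$ (Suc i, Suc j)"] B by (simp add: B'_def)
  qed (use B' in auto)
  from Suc.IH[OF B' this] obtain U d where U: "U \<in> carrier_mat n n"
    and UU: "mat_adjoint U * U = 1\<^sub>m n" "U * mat_adjoint U = 1\<^sub>m n"
    and B'U: "B' = U * mat_diag n (\<lambda>i. complex_of_real (d i)) * mat_adjoint U" by blast
  note U' = mat_adjoint_carrier[OF U]
  have BB': "B = corner_block n e B'"
    by (rule eq_matI) (use B B0 B0' e_cnj in \<open>auto simp: corner_block_def B'_def\<close>)
  define d' where "d' i = (case i of 0 \<Rightarrow> Re e | Suc i \<Rightarrow> d i)" for i
  define V where "V = corner_block n 1 U"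
  have V: "V \<in> carrier_mat (Suc n) (Suc n)" using U by (simp add: V_def)
  have V'_eq: "mat_adjoint V = corner_block n 1 (mat_adjoint U)"
    using corner_block_adjoint[OF U, of 1] by (simp add: V_def)
  note V' = mat_adjoint_carrier[OF V]
  have VV: "mat_adjoint V * V = 1\<^sub>m (Suc n)" "V * mat_adjoint V = 1\<^sub>m (Suc n)"
    unfolding V'_eq unfolding V_def using U U' UU
    by (simp_all add: corner_block_mult corner_block_one)
  define Dg where "Dg = mat_diag (Suc n) (\<lambda>i. complex_of_real (d' i))"
  have Dg: "Dg \<in> carrier_mat (Suc n) (Suc n)" by (simp add: Dg_def)
  have "Dg = corner_block n e (mat_diag n (\<lambda>i. complex_of_real (d i)))"
    using corner_block_diag[of n "\<lambda>i. complex_of_real (d' i)"] e by (simp add: d'_def Dg_def)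
  then have BV: "B = V * Dg * mat_adjoint V"
    unfolding V'_eq unfolding V_def BB' B'U using U U' by (simp add: corner_block_mult)
  have WVc: "mat_adjoint (W * V) = mat_adjoint V * mat_adjoint W"
    using W V by (rule mat_adjoint_mult)
  note assoc = assoc_mult_mat[of _ "Suc n" "Suc n" _ "Suc n" _ "Suc n"]
  show ?case
  proof (intro exI[of _ "W * V"] exI[of _ d'] conjI)
    have "mat_adjoint (W * V) * (W * V) = mat_adjoint V * ((mat_adjoint W * W) * V)"
      unfolding WVc using W W' V V' by (simp add: assoc)
    then show "mat_adjoint (W * V) * (W * V) = 1\<^sub>m (Suc n)" using V by (simp add: WW VV)
    have "(W * V) * mat_adjoint (W * V) = W * ((V * mat_adjoint V) * mat_adjoint W)"
      unfolding WVc using W W' V V' by (simp add: assoc)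
    then show "(W * V) * mat_adjoint (W * V) = 1\<^sub>m (Suc n)" by (simp add: VV left_mult_one_mat[OF W'] WW)
    have "A = W * (V * Dg * mat_adjoint V) * mat_adjoint W" using AWBW BV by simp
    also have "\<dots> = W * V * Dg * mat_adjoint (W * V)"
      unfolding WVc using W W' V V' Dg by (simp add: assoc)
    finally show "A = W * V * mat_diag (Suc n) (\<lambda>i. complex_of_real (d' i)) * mat_adjoint (W * V)"
      by (simp add: Dg_def)
  qed (use W V in auto)
qed

text \<open>As a simp rule this fact erases the carrier premises that the associativity rewrites below need.\<close>

declare mat_diag_dim [simp del]

text \<open>The matrix \<open>X\<close> of the change of basis intertwines the two diagonals.
  Entrywise, \<open>X $$ (i, j)\<close> can be nonzero only if \<open>d j = e i\<close>, and then
  \<open>f (d j) = f (e i)\<close>; so \<open>X\<close> intertwines the diagonals under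
  \<open>f\<close> as well. This makes \<open>hermitian_fun\<close> well defined.\<close>

lemma unitary_diag_fun_cong:
  fixes U V :: "complex mat"
  assumes U: "U \<in> carrier_mat n n" "mat_adjoint U * U = 1\<^sub>m n" "U * mat_adjoint U = 1\<^sub>m n"
    and V: "V \<in> carrier_mat n n" "mat_adjoint V * V = 1\<^sub>m n" "V * mat_adjoint V = 1\<^sub>m n"
    and eq: "U * mat_diag n d * mat_adjoint U = V * mat_diag n e * mat_adjoint V"
  shows "U * mat_diag n (\<lambda>i. f (d i)) * mat_adjoint U = V * mat_diag n (\<lambda>i. f (e i)) * mat_adjoint V"
proof -
  note U' = mat_adjoint_carrier[OF U(1)] and V' = mat_adjoint_carrier[OF V(1)]
  note assoc = assoc_mult_mat[of _ n n _ n _ n]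
  define X where "X = mat_adjoint V * U"
  have X: "X \<in> carrier_mat n n" using U V' by (simp add: X_def)
  have VX: "V * X = U" 
    using assoc[OF V(1) V' U(1)] U(1) V(3) by (simp add: X_def)
  have XU: "X * mat_adjoint U = mat_adjoint V"
    using assoc[OF V' U(1) U'] by (simp add: X_def U(3) right_mult_one_mat[OF V'])
  have "X * mat_diag n d = mat_adjoint V * (U * mat_diag n d * mat_adjoint U) * U"
    unfolding X_def using U(1) U' V' mat_diag_dim[of n d] by (simp add: assoc U(2) right_mult_one_mat[OF mat_diag_dim])
  also have "\<dots> = mat_diag n e * X"
    unfolding eq X_def using U(1) V(1) V' mat_diag_dim[of n e] assoc[OF V' V(1), of "mat_diag n e * (mat_adjoint V * U)"]
    by (simp add: assoc V(2) left_mult_one_mat[OF mult_carrier_mat[OF mat_diag_dim mult_carrier_mat[OF V' U(1)]]])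
  finally have XD: "X * mat_diag n d = mat_diag n e * X" .
  have Xd: "X $$ (i, j) * d j = e i * X $$ (i, j)" if "i < n" "j < n" for i j
    using arg_cong[OF XD, of "\<lambda>M. M $$ (i, j)"] that
    by (simp add: mat_diag_mult_left[OF X] mat_diag_mult_right[OF X])
  have Xf: "X * mat_diag n (\<lambda>i. f (d i)) = mat_diag n (\<lambda>i. f (e i)) * X"
    unfolding mat_diag_mult_left[OF X] mat_diag_mult_right[OF X]
  proof (rule eq_matI, goal_cases)
    case (1 i j)
    then have ij: "i < n" "j < n" by auto
    from Xd[OF ij] have "X $$ (i, j) * f (d j) = f (e i) * X $$ (i, j)"
      by (cases "X $$ (i, j) = 0") (auto simp: mult.commute)
    with ij show ?case by simp
  qed auto
  have "U * mat_diag n (\<lambda>i. f (d i)) * mat_adjoint U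
      = V * (X * mat_diag n (\<lambda>i. f (d i))) * mat_adjoint U"
    using assoc[OF V(1) X, of "mat_diag n (\<lambda>i. f (d i))"] mat_diag_dim[of n "\<lambda>i. f (d i)"]
    by (simp add: VX)
  also have "\<dots> = V * mat_diag n (\<lambda>i. f (e i)) * (X * mat_adjoint U)"
    unfolding Xf using V(1) X U' mat_diag_dim[of n "\<lambda>i. f (e i)"] by (simp add: assoc)
  finally show ?thesis unfolding XU .
qed

text \<open>The given decomposition witnesses the definite description, and
  \<open>unitary_diag_fun_cong\<close> excludes any other value.\<close>

lemma hermitian_fun_eq:
  assumes U: "U \<in> carrier_mat n n" "mat_adjoint U * U = 1\<^sub>m n" "U * mat_adjoint U = 1\<^sub>m n"
    and A: "A = U * mat_diag n (\<lambda>i. complex_of_real (d i)) * mat_adjoint U"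
  shows "hermitian_fun f A = U * mat_diag n (\<lambda>i. f (complex_of_real (d i))) * mat_adjoint U"
proof -
  have n: "dim_row A = n" using U(1) by (simp add: A)
  show ?thesis
    unfolding hermitian_fun_def Let_def n
  proof (rule the_equality, goal_cases)
    case 1
    then show ?case using U A by blast
  next
    case (2 B)
    then obtain V e where V: "V \<in> carrier_mat n n" "mat_adjoint V * V = 1\<^sub>m n" "V * mat_adjoint V = 1\<^sub>m n"
      and AV: "A = V * mat_diag n (\<lambda>i. complex_of_real (e i)) * mat_adjoint V"
      and B: "B = V * mat_diag n (\<lambda>i. f (complex_of_real (e i))) * mat_adjoint V" by blast
    show ?case
      unfolding B by (rule unitary_diag_fun_cong[OF V U, of _ _ f]) (use A AV in simp)
  qed
qed

section \<open>Spectrum, quadratic forms and resolvents in an eigenbasis\<close>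

lemma unitary_diag_spectrum:
  fixes U :: "complex mat"
  assumes U: "U \<in> carrier_mat n n" "mat_adjoint U * U = 1\<^sub>m n"
    and A: "A = U * mat_diag n d * mat_adjoint U" and i: "i < n"
  shows "d i \<in> spectrum A"
proof -
  note U' = mat_adjoint_carrier[OF U(1)]
  define v where "v = U *\<^sub>v unit_vec n i"
  have v: "v \<in> carrier_vec n" using U by (simp add: v_def)
  have U'v: "mat_adjoint U *\<^sub>v v = unit_vec n i"
    using assoc_mult_mat_vec[OF U' U(1), of "unit_vec n i"] U(2) by (simp add: v_def)
  have v0: "v \<noteq> 0\<^sub>v n"
  proof
    assume "v = 0\<^sub>v n"
    then have "(mat_adjoint U *\<^sub>v v) $ i = 0" using i U by (simp add: scalar_prod_def)
    with U'v i show False by simp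
  qed
  have "A *\<^sub>v v = U *\<^sub>v (mat_diag n d *\<^sub>v (mat_adjoint U *\<^sub>v v))"
    unfolding A using U U' v mat_diag_dim[of n d] by (simp add: assoc_mult_mat_vec[of _ n n _ n])
  also have "mat_diag n d *\<^sub>v (mat_adjoint U *\<^sub>v v) = d i \<cdot>\<^sub>v unit_vec n i"
    unfolding U'v by (rule eq_vecI) (use i in \<open>auto simp: mat_diag_def\<close>)
  also have "U *\<^sub>v (d i \<cdot>\<^sub>v unit_vec n i) = d i \<cdot>\<^sub>v v"
    unfolding v_def using U(1) by (simp add: mult_mat_vec)
  finally show ?thesis
    using v v0 U(1) by (auto simp: spectrum_def eigenvalue_def eigenvector_def A)
qed

text \<open>The weights do not depend on \<open>g\<close>. The same weights thus serve for
  \<open>f\<close> and for the kernels \<open>1 / (x - z)\<close>, which is what lets Cauchy's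
  formula act on the error.\<close>

lemma unitary_diag_quadratic_form:
  fixes U :: "complex mat"
  assumes U: "U \<in> carrier_mat n n" and x: "x \<in> carrier_vec n"
  shows "(U * mat_diag n g * mat_adjoint U *\<^sub>v x) \<bullet>c x
    = (\<Sum>i<n. g i * complex_of_real ((cmod ((mat_adjoint U *\<^sub>v x) $ i))\<^sup>2))"
proof -
  note U' = mat_adjoint_carrier[OF U]
  define y where "y = mat_adjoint U *\<^sub>v x"
  have y: "y \<in> carrier_vec n" using U' x by (simp add: y_def)
  have "(U * mat_diag n g * mat_adjoint U *\<^sub>v x) \<bullet>c x = (U *\<^sub>v (mat_diag n g *\<^sub>v y)) \<bullet>c x"
    using U U' x mat_diag_dim[of n g] by (simp add: y_def assoc_mult_mat_vec[of _ n n _ n])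
  also have "\<dots> = (mat_diag n g *\<^sub>v y) \<bullet>c y"
    unfolding y_def by (rule cscalar_prod_adjoint[OF U _ x]) (use mat_diag_dim[of n g] U' x in simp)
  also have "\<dots> = (\<Sum>i<n. g i * (y $ i * cnj (y $ i)))"
    unfolding cscalar_prod_eq_sum[OF y]
  proof (rule sum.cong[OF refl])
    fix i assume "i \<in> {..<n}"
    then have i: "i < n" by simp
    have "(mat_diag n g *\<^sub>v y) $ i = (\<Sum>j = 0..<n. (if i = j then g j else 0) * y $ j)"
      using i y by (simp add: mat_diag_def scalar_prod_def)
    also have "\<dots> = (\<Sum>j = 0..<n. if i = j then g j * y $ j else 0)"
      by (rule sum.cong[OF refl]) simp
    also have "\<dots> = g i * y $ i" using i by simp
    finally show "(mat_diag n g *\<^sub>v y) $ i * cnj (y $ i) = g i * (y $ i * cnj (y $ i))"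
      by simp
  qed
  finally show ?thesis
    by (simp add: y_def complex_norm_square del: of_real_power)
qed

lemma unitary_diag_form_bound:
  fixes U :: "complex mat"
  assumes U: "U \<in> carrier_mat n n" "U * mat_adjoint U = 1\<^sub>m n" and x: "x \<in> carrier_vec n"
    and M: "\<And>i. i < n \<Longrightarrow> cmod (g i) \<le> M"
  shows "cmod ((U * mat_diag n g * mat_adjoint U *\<^sub>v x) \<bullet>c x) \<le> M * (vnorm x)\<^sup>2"
proof -
  define q where "q i = (cmod ((mat_adjoint U *\<^sub>v x) $ i))\<^sup>2" for i
  \<comment> \<open>The constant function 1 in the quadratic form shows that the weights sum to the
    squared norm of \<open>x\<close>.\<close>
  have "complex_of_real ((vnorm x)\<^sup>2) = (U * mat_diag n (\<lambda>_. 1) * mat_adjoint U *\<^sub>v x) \<bullet>c x"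
    using U x by (simp add: vnorm_square del: of_real_power)
  also have "\<dots> = (\<Sum>i<n. 1 * complex_of_real (q i))"
    unfolding q_def by (rule unitary_diag_quadratic_form[OF U(1) x])
  also have "\<dots> = complex_of_real (\<Sum>i<n. q i)" by simp
  finally have q: "(\<Sum>i<n. q i) = (vnorm x)\<^sup>2" by (metis of_real_eq_iff)
  have "cmod (\<Sum>i<n. g i * complex_of_real (q i)) \<le> (\<Sum>i<n. M * q i)"
  proof (rule sum_norm_le)
    fix i assume "i \<in> {..<n}"
    moreover have "0 \<le> q i" by (simp add: q_def)
    ultimately show "cmod (g i * complex_of_real (q i)) \<le> M * q i"
      using M[of i] by (simp add: norm_mult mult_right_mono)
  qed
  also have "\<dots> = M * (vnorm x)\<^sup>2" by (simp add: q flip: sum_distrib_left)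
  finally show ?thesis
    unfolding unitary_diag_quadratic_form[OF U(1) x] q_def .
qed

lemma unitary_diag_shift:
  fixes U :: "complex mat"
  assumes U: "U \<in> carrier_mat n n" "U * mat_adjoint U = 1\<^sub>m n"
  shows "shift_mat (U * mat_diag n d * mat_adjoint U) z = U * mat_diag n (\<lambda>i. d i - z) * mat_adjoint U"
proof -
  note U' = mat_adjoint_carrier[OF U(1)]
  have "mat_diag n (\<lambda>i. d i - z) = mat_diag n d - z \<cdot>\<^sub>m 1\<^sub>m n"
    by (rule eq_matI) (auto simp: mat_diag_def)
  then have "U * mat_diag n (\<lambda>i. d i - z) * mat_adjoint U
      = U * mat_diag n d * mat_adjoint U - U * (z \<cdot>\<^sub>m 1\<^sub>m n) * mat_adjoint U"
    using U U' mat_diag_dim[of n d] by (simp add: mult_minus_distrib_mat[of _ n n _ n] minus_mult_distrib_mat[of _ n n _ _ n])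
  also have "U * (z \<cdot>\<^sub>m 1\<^sub>m n) * mat_adjoint U = z \<cdot>\<^sub>m 1\<^sub>m n"
    using U U' by (simp add: mult_smult_distrib[of _ n n _ n] mult_smult_assoc_mat[of _ n n _ n])
  finally show ?thesis using U by (simp add: shift_mat_def)
qed

lemma unitary_diag_mult:
  fixes U :: "complex mat"
  assumes U: "U \<in> carrier_mat n n" "mat_adjoint U * U = 1\<^sub>m n"
  shows "(U * mat_diag n f * mat_adjoint U) * (U * mat_diag n g * mat_adjoint U)
    = U * mat_diag n (\<lambda>i. f i * g i) * mat_adjoint U"
proof -
  note U' = mat_adjoint_carrier[OF U(1)]
  note assoc = assoc_mult_mat[of _ n n _ n _ n]
  have "(U * mat_diag n f * mat_adjoint U) * (U * mat_diag n g * mat_adjoint U)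
      = U * (mat_diag n f * ((mat_adjoint U * U) * (mat_diag n g * mat_adjoint U)))"
    using U(1) U' mat_diag_dim[of n f] mat_diag_dim[of n g] by (simp add: assoc)
  also have "\<dots> = U * ((mat_diag n f * mat_diag n g) * mat_adjoint U)"
    unfolding U(2) using U' mat_diag_dim[of n f] mat_diag_dim[of n g]
    by (simp add: assoc left_mult_one_mat[OF mult_carrier_mat[OF mat_diag_dim U']] del: mat_diag_diag)
  finally show ?thesis using U(1) U' mat_diag_dim[of n "\<lambda>i. f i * g i"] by (simp add: assoc)
qed

lemma unitary_diag_resolvent:
  fixes U :: "complex mat"
  assumes U: "U \<in> carrier_mat n n" "mat_adjoint U * U = 1\<^sub>m n" "U * mat_adjoint U = 1\<^sub>m n"
    and z: "\<And>i. i < n \<Longrightarrow> d i \<noteq> z"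
  defines "A \<equiv> U * mat_diag n d * mat_adjoint U"
    and "R \<equiv> U * mat_diag n (\<lambda>i. 1 / (d i - z)) * mat_adjoint U"
  shows "shift_mat A z * R = 1\<^sub>m n" and "R * shift_mat A z = 1\<^sub>m n"
proof -
  have "mat_diag n (\<lambda>i. (d i - z) * (1 / (d i - z))) = 1\<^sub>m n"
    "mat_diag n (\<lambda>i. (1 / (d i - z)) * (d i - z)) = 1\<^sub>m n"
    by (rule eq_matI; use z in \<open>auto simp: mat_diag_def\<close>)+
  then show "shift_mat A z * R = 1\<^sub>m n" "R * shift_mat A z = 1\<^sub>m n"
    unfolding A_def R_def unitary_diag_shift[OF U(1,3)] unitary_diag_mult[OF U(1,2)]
    using U by simp_all
qed

section \<open>Shifted matrices, their determinants and inverses\<close>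

lemma shift_mat_carrier: "B \<in> carrier_mat m m \<Longrightarrow> shift_mat B z \<in> carrier_mat m m"
  by (rule carrier_matI) (simp_all add: shift_mat_def)

lemma shift_mat_mult_vec:
  assumes "B \<in> carrier_mat m m" and "x \<in> carrier_vec m"
  shows "shift_mat B z *\<^sub>v x = B *\<^sub>v x - z \<cdot>\<^sub>v x"
proof -
  have "(z \<cdot>\<^sub>m 1\<^sub>m m) *\<^sub>v x = z \<cdot>\<^sub>v x"
    by (rule eq_vecI) (use assms in \<open>auto simp: scalar_prod_smult_distrib\<close>)
  then show ?thesis
    using assms minus_mult_distrib_mat_vec[of B m m "z \<cdot>\<^sub>m 1\<^sub>m m" x] by (simp add: shift_mat_def)
qed

lemma shift_mat_adjoint:
  assumes "B \<in> carrier_mat m m" and "mat_adjoint B = B"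
  shows "mat_adjoint (shift_mat B z) = shift_mat B (cnj z)"
proof (rule eq_matI)
  fix i j assume "i < dim_row (shift_mat B (cnj z))" "j < dim_col (shift_mat B (cnj z))"
  then have ij: "i < m" "j < m" using assms(1) by (auto simp: shift_mat_def)
  have "B $$ (i, j) = cnj (B $$ (j, i))"
    using arg_cong[OF assms(2), of "\<lambda>M. M $$ (i, j)"] ij assms(1) by simp
  then show "mat_adjoint (shift_mat B z) $$ (i, j) = shift_mat B (cnj z) $$ (i, j)"
    using ij assms(1) by (simp add: shift_mat_def)
qed (use assms(1) in \<open>auto simp: shift_mat_def\<close>)

text \<open>The characteristic polynomial is the determinant of \<open>z I - B\<close>, hence the
  sign.\<close>

lemma det_shift_mat:
  assumes "B \<in> carrier_mat m m"
  shows "det (shift_mat B z) = (- 1) ^ m * poly (char_poly B) z"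
proof -
  have "shift_mat B z = char_matrix B z"
    by (rule eq_matI) (use assms in \<open>auto simp: shift_mat_def char_matrix_def\<close>)
  moreover have "poly (char_poly B) z = det (- char_matrix B z)"
    by (rule char_poly_matrix[OF assms])
  moreover have "det (- char_matrix B z) = (- 1) ^ m * det (char_matrix B z)"
  proof -
    have "- char_matrix B z = (- 1) \<cdot>\<^sub>m char_matrix B z"
      by (rule eq_matI) auto
    then show ?thesis using assms by (simp add: det_smult char_matrix_def)
  qed
  ultimately show ?thesis by (simp flip: mult.assoc power_mult_distrib)
qed

text \<open>\<open>mat_inverse\<close> returns an option. Off the spectrum the determinant is
  nonzero, so \<open>the\<close> is applied to an actual inverse.\<close>

lemma mat_inverse_shift_mat:
  assumes B: "B \<in> carrier_mat m m" and z: "z \<notin> spectrum B"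
  shows "the (mat_inverse (shift_mat B z)) \<in> carrier_mat m m"
    and "shift_mat B z * the (mat_inverse (shift_mat B z)) = 1\<^sub>m m"
proof -
  have "det (shift_mat B z) \<noteq> 0"
    using z by (simp add: det_shift_mat[OF B] spectrum_root_char_poly[OF B])
  from det_non_zero_imp_unit[OF shift_mat_carrier[OF B] this, where b = "()"]
  obtain X where X: "mat_inverse (shift_mat B z) = Some X"
    using mat_inverse(1)[OF shift_mat_carrier[OF B, of z], where b = "()"]
    by (cases "mat_inverse (shift_mat B z)") auto
  from mat_inverse(2)[OF shift_mat_carrier[OF B] X]
  show "the (mat_inverse (shift_mat B z)) \<in> carrier_mat m m"
    "shift_mat B z * the (mat_inverse (shift_mat B z)) = 1\<^sub>m m"
    by (simp_all add: X)
qed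

section \<open>The Lanczos process\<close>

text \<open>Only \<open>\<beta> 1\<close> to \<open>\<beta> (k - 1)\<close> are nonzero by
  assumption; \<open>\<beta> k\<close> may vanish. The last step is therefore described by the
  unnormalized vector \<open>qt k\<close> instead of \<open>q (k + 1)\<close>.\<close>

locale lanczos_process =
  fixes A :: "complex mat" and b :: "complex vec" and n k :: nat
  assumes A: "A \<in> carrier_mat n n" and hermitian: "mat_adjoint A = A"
    and b: "b \<in> carrier_vec n" and b_nz: "b \<noteq> 0\<^sub>v n"
    and k: "1 \<le> k" and no_breakdown: "\<forall>j\<in>{1..<k}. lanczos_beta A b j \<noteq> 0"
begin

abbreviation "q \<equiv> lanczos_q A b"
abbreviation "qt \<equiv> lanczos_qt A b"
abbreviation "\<alpha> \<equiv> lanczos_alpha A b"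
abbreviation "\<beta> \<equiv> lanczos_beta A b"
abbreviation "Q \<equiv> lanczos_Q A b k"
abbreviation "T \<equiv> lanczos_T A b k"

lemmas q_simps = lanczos_q.simps lanczos_beta.simps
declare lanczos_q.simps [simp del] lanczos_beta.simps [simp del]
  lanczos_alpha.simps [simp del] lanczos_qt.simps [simp del]

section \<open>Orthonormality of the Lanczos vectors\<close>

lemma qt_carrier_if: "q j \<in> carrier_vec n \<Longrightarrow> qt j \<in> carrier_vec n"
  unfolding lanczos_qt.simps[of A b j] by (rule carrier_vecI) (use carrier_vecD[of "q j" n] in simp)

lemma q_carrier: "q j \<in> carrier_vec n"
proof (induction j)
  case 0
  then show ?case using b by (simp add: q_simps)
next
  case (Suc j)
  then show ?case using b qt_carrier_if by (cases j) (simp_all add: q_simps)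
qed

lemma qt_carrier: "qt j \<in> carrier_vec n"
  using q_carrier by (rule qt_carrier_if)

text \<open>This survives a breakdown: \<open>\<beta> j\<close> is the norm of \<open>qt j\<close>,
  so if it is 0 both sides are the zero vector.\<close>

lemma qt_eq:
  assumes "1 \<le> j"
  shows "qt j = complex_of_real (\<beta> j) \<cdot>\<^sub>v q (Suc j)"
proof -
  obtain i where j: "j = Suc i" using assms by (cases j) auto
  show ?thesis
  proof (cases "\<beta> j = 0")
    case True
    then have "qt j = 0\<^sub>v n"
      using vnorm_eq_0_iff[OF qt_carrier, of j] by (simp add: j q_simps)
    then show ?thesis using True q_carrier[of "Suc j"] by auto
  next
    case False
    then show ?thesis by (simp add: j q_simps(3) smult_smult_assoc)
  qed
qed

lemma three_term:
  "A *\<^sub>v q j = complex_of_real (\<beta> (j - 1)) \<cdot>\<^sub>v q (j - 1) + \<alpha> j \<cdot>\<^sub>v q j + qt j"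
  unfolding lanczos_qt.simps[of A b j]
  by (rule eq_vecI) (use A q_carrier[of j] q_carrier[of "j - 1"] in auto)

definition orthonormal_upto :: "nat \<Rightarrow> bool" where
  "orthonormal_upto l \<longleftrightarrow> (\<forall>i\<in>{1..l}. \<forall>j\<in>{1..l}. q i \<bullet>c q j = (if i = j then 1 else 0))"

lemma orthonormal_uptoD:
  assumes "orthonormal_upto l" and "i \<in> {1..l}" and "j \<le> l"
  shows "q i \<bullet>c q j = (if i = j then 1 else 0)"
  using assms b q_carrier[of i]
  by (cases "j = 0") (auto simp: orthonormal_upto_def q_simps)

lemma A_self_adjoint:
  "x \<in> carrier_vec n \<Longrightarrow> y \<in> carrier_vec n \<Longrightarrow> (A *\<^sub>v x) \<bullet>c y = x \<bullet>c (A *\<^sub>v y)"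
  using cscalar_prod_adjoint[OF A, of x y] by (simp add: hermitian)

text \<open>Against \<open>q l\<close> this is the choice of \<open>\<alpha> l\<close>. Against an
  earlier \<open>q i\<close>, self-adjointness moves \<open>A\<close> to \<open>q i\<close>, whose
  image involves only the indices \<open>i - 1\<close>, \<open>i\<close> and \<open>i + 1\<close>. A
  contribution is left only for \<open>i + 1 = l\<close>, and it is cancelled by the subtracted
  \<open>\<beta> (l - 1)\<close> term.\<close>

lemma qt_orthogonal:
  assumes orth: "orthonormal_upto l" and i: "i \<in> {1..l}"
  shows "qt l \<bullet>c q i = 0"
proof -
  note c = q_carrier qt_carrier
  have Ac: "A *\<^sub>v q j \<in> carrier_vec n" for j using A c by simp
  define p where "p = A *\<^sub>v q l - complex_of_real (\<beta> (l - 1)) \<cdot>\<^sub>v q (l - 1)"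
  have p: "p \<in> carrier_vec n" using Ac c by (simp add: p_def)
  have qt: "qt l = p - \<alpha> l \<cdot>\<^sub>v q l" by (simp add: lanczos_qt.simps[of A b l] p_def)
  have al: "\<alpha> l = p \<bullet>c q l" by (simp add: lanczos_alpha.simps[of A b l] p_def)
  have 1: "qt l \<bullet>c q i = p \<bullet>c q i - \<alpha> l * (q l \<bullet>c q i)"
    unfolding qt using p c by (simp add: cscalar_prod_minus_left[of _ n] cscalar_prod_smult_left[of _ n])
  show ?thesis
  proof (cases "i = l")
    case True
    then show ?thesis using 1 al orthonormal_uptoD[OF orth i, of l] by simp
  next
    case False
    then have il: "1 \<le> i" "i < l" using i by auto
    have "p \<bullet>c q i = q l \<bullet>c (A *\<^sub>v q i) - complex_of_real (\<beta> (l - 1)) * (q (l - 1) \<bullet>c q i)"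
      unfolding p_def using Ac c
      by (simp add: cscalar_prod_minus_left[of _ n] cscalar_prod_smult_left[of _ n] A_self_adjoint)
    also have "q (l - 1) \<bullet>c q i = (if l = Suc i then 1 else 0)"
      using orthonormal_uptoD[OF orth, of "l - 1" i] il by auto
    also have "q l \<bullet>c (A *\<^sub>v q i) = complex_of_real (\<beta> (i - 1)) * (q l \<bullet>c q (i - 1))
        + cnj (\<alpha> i) * (q l \<bullet>c q i) + complex_of_real (\<beta> i) * (q l \<bullet>c q (Suc i))"
      unfolding three_term[of i] qt_eq[OF il(1)] using c
      by (simp add: cscalar_prod_add_right[of _ n] cscalar_prod_smult_right[of _ n])
    also have "\<dots> = complex_of_real (\<beta> i) * (if l = Suc i then 1 else 0)"
      using orthonormal_uptoD[OF orth, of l] il by auto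
    finally have "p \<bullet>c q i = 0" by auto
    then show ?thesis using 1 orthonormal_uptoD[OF orth, of l i] il by auto
  qed
qed

lemma orthonormal:
  assumes "l \<le> k"
  shows "orthonormal_upto l"
  using assms
proof (induction l)
  case 0
  then show ?case by (simp add: orthonormal_upto_def)
next
  case (Suc l)
  then have IH: "orthonormal_upto l" by simp
  have unit: "q (Suc l) \<bullet>c q (Suc l) = 1"
  proof -
    \<comment> \<open>\<open>v\<close> is the vector that is normalized to \<open>q (l + 1)\<close>:
      the start vector \<open>b\<close> in the first step, \<open>qt l\<close> afterwards.\<close>
    define v where "v = (if l = 0 then b else qt l)"
    have v: "v \<in> carrier_vec n" using b qt_carrier by (simp add: v_def)
    have nz: "vnorm v \<noteq> 0"
    proof (cases l)
      case 0
      then show ?thesis using vnorm_eq_0_iff[OF b] b_nz by (simp add: v_def)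
    next
      case (Suc i)
      then show ?thesis using no_breakdown Suc.prems by (force simp: v_def q_simps)
    qed
    have "q (Suc l) = complex_of_real (1 / vnorm v) \<cdot>\<^sub>v v"
      by (cases l) (simp_all add: v_def q_simps)
    then have "q (Suc l) \<bullet>c q (Suc l)
        = complex_of_real (1 / vnorm v) * (complex_of_real (1 / vnorm v) * (v \<bullet>c v))"
      using v by (simp add: cscalar_prod_smult_left[of _ n] cscalar_prod_smult_right[of _ n])
    then show ?thesis
      using nz unfolding vnorm_square[symmetric] by (simp add: power2_eq_square)
  qed
  have orth: "q (Suc l) \<bullet>c q i = 0" if i: "i \<in> {1..l}" for i
  proof -
    have l: "1 \<le> l" and "\<beta> l \<noteq> 0" using i no_breakdown Suc.prems by auto
    then have "q (Suc l) = complex_of_real (1 / \<beta> l) \<cdot>\<^sub>v qt l"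
      by (simp add: qt_eq smult_smult_assoc)
    then show ?thesis
      using qt_orthogonal[OF IH i] qt_carrier q_carrier by (simp add: cscalar_prod_smult_left[of _ n])
  qed
  have orth': "q i \<bullet>c q (Suc l) = 0" if i: "i \<in> {1..l}" for i
    using cnj_cscalar_prod[OF q_carrier q_carrier, of "Suc l" i] orth[OF i] by simp
  show ?case
    unfolding orthonormal_upto_def
  proof (intro ballI)
    fix i j assume ij: "i \<in> {1..Suc l}" "j \<in> {1..Suc l}"
    consider "i = Suc l" "j = Suc l" | "i = Suc l" "j \<in> {1..l}" | "i \<in> {1..l}" "j = Suc l"
      | "i \<in> {1..l}" "j \<in> {1..l}"
      using ij by fastforce
    then show "q i \<bullet>c q j = (if i = j then 1 else 0)"
    proof cases
      case 4
      then show ?thesis using IH by (simp add: orthonormal_upto_def)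
    qed (use unit orth orth' in auto)
  qed
qed

text \<open>Needed for \<open>T\<close> to be Hermitian, since \<open>\<alpha>\<close> is complex by
  type. Orthogonality removes the \<open>\<beta>\<close> term, and the remaining quadratic form of
  \<open>A\<close> at \<open>q j\<close> is real.\<close>

lemma alpha_real:
  assumes j: "j \<in> {1..k}"
  shows "cnj (\<alpha> j) = \<alpha> j"
proof -
  have Ac: "A *\<^sub>v q j \<in> carrier_vec n" for j using A q_carrier by simp
  have "q (j - 1) \<bullet>c q j = 0"
  proof (cases "j = 1")
    case True
    then show ?thesis using b q_carrier[of 1] by (simp add: q_simps(1) scalar_prod_def)
  next
    case False
    then have "j - 1 \<in> {1..k}" "j \<le> k" "j - 1 \<noteq> j" using j by auto
    then show ?thesis using orthonormal_uptoD[OF orthonormal, of k "j - 1" j] by simp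
  qed
  then have "\<alpha> j = (A *\<^sub>v q j) \<bullet>c q j"
    unfolding lanczos_alpha.simps[of A b j] using Ac q_carrier
    by (simp add: cscalar_prod_minus_left[of _ n] cscalar_prod_smult_left[of _ n])
  then show ?thesis
    using cnj_cscalar_prod[OF Ac q_carrier, of j j] A_self_adjoint[OF q_carrier q_carrier, of j j]
    by simp
qed

section \<open>The matrices \<open>Q\<close> and \<open>T\<close> and the Lanczos relation\<close>

lemma Q_carrier: "Q \<in> carrier_mat n k"
  using b by (simp add: lanczos_Q_def mat_of_cols_def del: upt_Suc)

lemma Q_index: "i < n \<Longrightarrow> j < k \<Longrightarrow> Q $$ (i, j) = q (Suc j) $ i"
  using b by (simp add: lanczos_Q_def mat_of_cols_def del: upt_Suc)

lemma T_carrier: "T \<in> carrier_mat k k"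
  by (simp add: lanczos_T_def)

lemma T_hermitian: "mat_adjoint T = T"
  by (rule eq_matI) (use alpha_real in \<open>auto simp: lanczos_T_def\<close>)

lemma adjoint_Q_mult:
  assumes "x \<in> carrier_vec n" and "j < k"
  shows "(mat_adjoint Q *\<^sub>v x) $ j = x \<bullet>c q (Suc j)"
proof -
  have "(mat_adjoint Q *\<^sub>v x) $ j = (\<Sum>i = 0..<n. cnj (Q $$ (i, j)) * x $ i)"
    using Q_carrier assms by (simp add: scalar_prod_def)
  also have "\<dots> = (\<Sum>i<n. x $ i * cnj (q (Suc j) $ i))"
    unfolding lessThan_atLeast0 by (rule sum.cong[OF refl]) (use assms in \<open>simp add: Q_index mult.commute\<close>)
  finally show ?thesis by (simp add: cscalar_prod_eq_sum[OF q_carrier])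
qed

text \<open>All residuals turn out to be multiples of \<open>qt k\<close>, so this is the Galerkin
  orthogonality of the residual to the range of \<open>Q\<close>.\<close>

lemma adjoint_Q_qt: "mat_adjoint Q *\<^sub>v qt k = 0\<^sub>v k"
  by (rule eq_vecI)
    (use Q_carrier adjoint_Q_mult[OF qt_carrier] qt_orthogonal[OF orthonormal] in auto)

lemma b_eq: "b = complex_of_real (vnorm b) \<cdot>\<^sub>v q 1"
  using vnorm_eq_0_iff[OF b] b_nz by (simp add: q_simps smult_smult_assoc)

lemma adjoint_Q_b: "mat_adjoint Q *\<^sub>v b = complex_of_real (vnorm b) \<cdot>\<^sub>v unit_vec k 0"
proof (rule eq_vecI)
  fix j assume "j < dim_vec (complex_of_real (vnorm b) \<cdot>\<^sub>v (unit_vec k 0 :: complex vec))"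
  then have j: "j < k" by simp
  have "b \<bullet>c q (Suc j) = complex_of_real (vnorm b) * (q 1 \<bullet>c q (Suc j))"
    by (subst b_eq) (rule cscalar_prod_smult_left[OF q_carrier q_carrier])
  also have "q 1 \<bullet>c q (Suc j) = (if j = 0 then 1 else 0)"
    using orthonormal_uptoD[OF orthonormal, of k 1 "Suc j"] j by auto
  finally show "(mat_adjoint Q *\<^sub>v b) $ j = (complex_of_real (vnorm b) \<cdot>\<^sub>v unit_vec k 0) $ j"
    using j by (auto simp: adjoint_Q_mult[OF b])
qed (use Q_carrier in simp)

text \<open>The projection onto the range of \<open>Q\<close> fixes \<open>b\<close>, which is a
  multiple of the first column.\<close>

lemma Q_adjoint_Q_b: "Q *\<^sub>v (mat_adjoint Q *\<^sub>v b) = b"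
proof (rule eq_vecI)
  fix i assume i: "i < dim_vec b"
  then have "(Q *\<^sub>v (mat_adjoint Q *\<^sub>v b)) $ i
      = (\<Sum>j = 0..<k. Q $$ (i, j) * (complex_of_real (vnorm b) * (if j = 0 then 1 else 0)))"
    unfolding adjoint_Q_b using Q_carrier b by (simp add: scalar_prod_def unit_vec_def)
  also have "\<dots> = (\<Sum>j = 0..<k. if j = 0 then Q $$ (i, j) * complex_of_real (vnorm b) else 0)"
    by (rule sum.cong[OF refl]) simp
  also have "\<dots> = Q $$ (i, 0) * complex_of_real (vnorm b)" using k by simp
  also have "\<dots> = (complex_of_real (vnorm b) \<cdot>\<^sub>v q 1) $ i"
    using i b k q_carrier[of 1] by (simp add: Q_index mult.commute)
  finally show "(Q *\<^sub>v (mat_adjoint Q *\<^sub>v b)) $ i = b $ i" using b_eq by simp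
qed (use Q_carrier b in simp)

lemma A_Q: "A * Q = Q * T + Matrix.mat n k (\<lambda>(i, j). if j = k - 1 then qt k $ i else 0)"
  (is "_ = _ + ?R")
proof (rule eq_matI)
  fix i j assume "i < dim_row (Q * T + ?R)" "j < dim_col (Q * T + ?R)"
  then have i: "i < n" and j: "j < k" by auto
  have colQ: "col Q j = q (Suc j)"
    by (rule eq_vecI) (use Q_carrier j Q_index q_carrier[of "Suc j"] in auto)
  have "(A * Q) $$ (i, j) = (A *\<^sub>v q (Suc j)) $ i"
    using A Q_carrier i j colQ by simp
  also have "\<dots> = \<beta> j * q j $ i + \<alpha> (Suc j) * q (Suc j) $ i + qt (Suc j) $ i"
    unfolding three_term[of "Suc j"] using i q_carrier[of j] q_carrier[of "Suc j"] qt_carrier[of "Suc j"]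
    by simp
  finally have lhs: "(A * Q) $$ (i, j) = \<dots>" .
  have "(Q * T) $$ (i, j) = (\<Sum>l = 0..<k. q (Suc l) $ i * T $$ (l, j))"
    using Q_carrier T_carrier i j by (simp add: scalar_prod_def Q_index)
  \<comment> \<open>Column \<open>j\<close> of \<open>T\<close> can be nonzero only in the rows
    \<open>j - 1\<close>, \<open>j\<close> and \<open>j + 1\<close>, and row \<open>l\<close> is
    paired with \<open>q (l + 1)\<close>.\<close>
  also have "\<dots> = (\<Sum>l = 0..<k. (if l = j then q (Suc j) $ i * \<alpha> (Suc j) else 0)
      + (if j = Suc l then q j $ i * \<beta> j else 0)
      + (if l = Suc j then q (Suc (Suc j)) $ i * \<beta> (Suc j) else 0))"
    by (rule sum.cong[OF refl]) (use j in \<open>auto simp: lanczos_T_def\<close>)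
  also have "\<dots> = q (Suc j) $ i * \<alpha> (Suc j) + (\<Sum>l = 0..<k. if j = Suc l then q j $ i * \<beta> j else 0)
      + (if Suc j < k then q (Suc (Suc j)) $ i * \<beta> (Suc j) else 0)"
    using j by (simp add: sum.distrib)
  \<comment> \<open>For \<open>j = 0\<close> no index matches, in agreement with
    \<open>\<beta> 0 = 0\<close>.\<close>
  also have "(\<Sum>l = 0..<k. if j = Suc l then q j $ i * \<beta> j else 0) = q j $ i * \<beta> j"
    using j by (cases j) (auto simp: q_simps(4))
  also have "(if Suc j < k then q (Suc (Suc j)) $ i * \<beta> (Suc j) else 0)
      = (if Suc j < k then qt (Suc j) $ i else 0)"
    using i q_carrier[of "Suc (Suc j)"] by (simp add: qt_eq mult.commute)
  finally have "(Q * T) $$ (i, j) = q (Suc j) $ i * \<alpha> (Suc j) + q j $ i * \<beta> j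
      + (if Suc j < k then qt (Suc j) $ i else 0)" .
  \<comment> \<open>In the last column \<open>Suc j = k\<close>, and the remainder supplies the
    vector whose coefficient is cut off in \<open>T\<close>.\<close>
  moreover have "?R $$ (i, j) = (if Suc j < k then 0 else qt (Suc j) $ i)"
    using i j by (auto simp: not_less intro!: arg_cong[of _ _ "\<lambda>l. qt l $ i"])
  ultimately show "(A * Q) $$ (i, j) = (Q * T + ?R) $$ (i, j)"
    unfolding lhs using i j Q_carrier T_carrier by (simp add: mult.commute)
qed (use A Q_carrier T_carrier in auto)

section \<open>Residuals and their dependence on the shift\<close>

lemma A_Q_mult_vec:
  assumes y: "y \<in> carrier_vec k"
  shows "A *\<^sub>v (Q *\<^sub>v y) = Q *\<^sub>v (T *\<^sub>v y) + y $ (k - 1) \<cdot>\<^sub>v qt k"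
proof -
  define R where "R = Matrix.mat n k (\<lambda>(i, j). if j = k - 1 then qt k $ i else 0)"
  have R: "R \<in> carrier_mat n k" by (simp add: R_def)
  have "R *\<^sub>v y = y $ (k - 1) \<cdot>\<^sub>v qt k"
  proof (rule eq_vecI)
    fix i assume "i < dim_vec (y $ (k - 1) \<cdot>\<^sub>v qt k)"
    then have i: "i < n" using qt_carrier[of k] by simp
    then have "(R *\<^sub>v y) $ i = (\<Sum>j = 0..<k. (if j = k - 1 then qt k $ i else 0) * y $ j)"
      using y by (simp add: R_def scalar_prod_def)
    also have "\<dots> = (\<Sum>j = 0..<k. if j = k - 1 then qt k $ i * y $ j else 0)"
      by (rule sum.cong[OF refl]) simp
    also have "\<dots> = qt k $ i * y $ (k - 1)" using k by simp
    finally show "(R *\<^sub>v y) $ i = (y $ (k - 1) \<cdot>\<^sub>v qt k) $ i"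
      using i qt_carrier[of k] by simp
  qed (use qt_carrier[of k] in \<open>simp add: R_def\<close>)
  moreover have "A *\<^sub>v (Q *\<^sub>v y) = (Q * T + R) *\<^sub>v y"
    using assoc_mult_mat_vec[OF A Q_carrier y] A_Q by (simp add: R_def)
  moreover have "(Q * T + R) *\<^sub>v y = Q *\<^sub>v (T *\<^sub>v y) + R *\<^sub>v y"
    using add_mult_distrib_mat_vec[OF mult_carrier_mat[OF Q_carrier T_carrier] R y]
      assoc_mult_mat_vec[OF Q_carrier T_carrier y] by simp
  ultimately show ?thesis by simp
qed

text \<open>Since \<open>b\<close> lies in the range of \<open>Q\<close>, the projected equation
  lifts to one for \<open>b\<close> itself. Subtracting the Lanczos relation leaves only its
  rank-one remainder.\<close>

lemma residual_eq:
  assumes y: "y \<in> carrier_vec k" and eq: "shift_mat T z *\<^sub>v y = mat_adjoint Q *\<^sub>v b"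
  shows "b - shift_mat A z *\<^sub>v (Q *\<^sub>v y) = - (y $ (k - 1)) \<cdot>\<^sub>v qt k"
proof -
  have Qy: "Q *\<^sub>v y \<in> carrier_vec n" using Q_carrier y by simp
  have Ty: "T *\<^sub>v y \<in> carrier_vec k" using T_carrier y by simp
  have QTy: "Q *\<^sub>v (T *\<^sub>v y) \<in> carrier_vec n" using Q_carrier Ty by simp
  have "b = Q *\<^sub>v (T *\<^sub>v y - z \<cdot>\<^sub>v y)"
    using Q_adjoint_Q_b eq shift_mat_mult_vec[OF T_carrier y, of z] by simp
  also have "\<dots> = Q *\<^sub>v (T *\<^sub>v y) - z \<cdot>\<^sub>v (Q *\<^sub>v y)"
    using mult_minus_distrib_mat_vec[OF Q_carrier Ty, of "z \<cdot>\<^sub>v y"] y mult_mat_vec[OF Q_carrier y, of z]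
    by simp
  finally have b': "b = Q *\<^sub>v (T *\<^sub>v y) - z \<cdot>\<^sub>v (Q *\<^sub>v y)" .
  have "shift_mat A z *\<^sub>v (Q *\<^sub>v y) = Q *\<^sub>v (T *\<^sub>v y) + y $ (k - 1) \<cdot>\<^sub>v qt k - z \<cdot>\<^sub>v (Q *\<^sub>v y)"
    using shift_mat_mult_vec[OF A Qy] A_Q_mult_vec[OF y] by simp
  then have "b - shift_mat A z *\<^sub>v (Q *\<^sub>v y) = (Q *\<^sub>v (T *\<^sub>v y) - z \<cdot>\<^sub>v (Q *\<^sub>v y))
      - (Q *\<^sub>v (T *\<^sub>v y) + y $ (k - 1) \<cdot>\<^sub>v qt k - z \<cdot>\<^sub>v (Q *\<^sub>v y))"
    using b' by metis
  also have "\<dots> = - (y $ (k - 1)) \<cdot>\<^sub>v qt k"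
    by (rule eq_vecI) (use carrier_vecD[OF Qy] carrier_vecD[OF QTy] carrier_vecD[OF qt_carrier[of k]] in
        \<open>simp_all del: index_mult_mat_vec dim_mult_mat_vec\<close>)
  finally show ?thesis .
qed

text \<open>Deleting the first row and the last column of \<open>T - z I\<close> leaves an upper triangular matrix
  with diagonal \<open>\<beta>\<^sub>1, \<dots>, \<beta>\<^sub>k\<^sub>-\<^sub>1\<close>, so this cofactor does not depend on \<open>z\<close>.\<close>

lemma corner_cofactor:
  "cofactor (shift_mat T z) 0 (k - 1)
    = (- 1) ^ (k - 1) * (\<Prod>i\<leftarrow>[0..<k - 1]. complex_of_real (\<beta> (Suc i)))"
proof -
  define M where "M = mat_delete (shift_mat T z) 0 (k - 1)"
  have M: "M \<in> carrier_mat (k - 1) (k - 1)"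
    unfolding M_def by (rule mat_delete_carrier[OF shift_mat_carrier[OF T_carrier]])
  have Mij: "M $$ (i, j) = shift_mat T z $$ (Suc i, j)" if "i < k - 1" "j < k - 1" for i j
    unfolding M_def mat_delete_def using that T_carrier by (simp add: shift_mat_def)
  have "upper_triangular M"
    unfolding upper_triangular_def
  proof (intro allI impI)
    \<comment> \<open>Row \<open>i\<close> of \<open>M\<close> is row \<open>i + 1\<close> of the
      shifted matrix, so \<open>j < i\<close> means at least two places below the diagonal of the
      tridiagonal \<open>T\<close>.\<close>
    fix i j assume "i < dim_row M" "j < i"
    then show "M $$ (i, j) = 0"
      using M Mij[of i j] by (simp add: shift_mat_def lanczos_T_def)
  qed
  then have "det M = prod_list (diag_mat M)"
    by (rule det_upper_triangular) (rule M)
  also have "diag_mat M = map (\<lambda>i. complex_of_real (\<beta> (Suc i))) [0..<k - 1]"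
    unfolding diag_mat_def using M Mij by (auto simp: shift_mat_def lanczos_T_def)
  finally show ?thesis
    by (simp add: cofactor_def M_def)
qed

text \<open>Cramer's rule for a right side along the first unit vector. \<open>C\<close> is fixed
  before \<open>y\<close> and \<open>z\<close>, so that residuals at different shifts can be
  compared.\<close>

lemma last_entry:
  obtains C where "\<And>y z. y \<in> carrier_vec k \<Longrightarrow> shift_mat T z *\<^sub>v y = mat_adjoint Q *\<^sub>v b \<Longrightarrow>
    y $ (k - 1) * poly (char_poly T) z = C"
proof
  fix y z assume y: "y \<in> carrier_vec k" and eq: "shift_mat T z *\<^sub>v y = mat_adjoint Q *\<^sub>v b"
  define S where "S = shift_mat T z"
  have S: "S \<in> carrier_mat k k" unfolding S_def by (rule shift_mat_carrier[OF T_carrier])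
  have "det S \<cdot>\<^sub>v y = (det S \<cdot>\<^sub>m 1\<^sub>m k) *\<^sub>v y"
    by (rule eq_vecI) (use y in auto)
  also have "\<dots> = adj_mat S *\<^sub>v (S *\<^sub>v y)"
    using adj_mat[OF S] assoc_mult_mat_vec[OF adj_mat(1)[OF S] S y] by simp
  also have "S *\<^sub>v y = complex_of_real (vnorm b) \<cdot>\<^sub>v unit_vec k 0"
    using eq by (simp add: S_def adjoint_Q_b)
  also have "adj_mat S *\<^sub>v (complex_of_real (vnorm b) \<cdot>\<^sub>v unit_vec k 0)
      = complex_of_real (vnorm b) \<cdot>\<^sub>v (adj_mat S *\<^sub>v unit_vec k 0)"
    using adj_mat(1)[OF S] by (simp add: mult_mat_vec)
  finally have "(det S \<cdot>\<^sub>v y) $ (k - 1)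
      = (complex_of_real (vnorm b) \<cdot>\<^sub>v (adj_mat S *\<^sub>v unit_vec k 0)) $ (k - 1)" by simp
  \<comment> \<open>The adjugate transposes indices: its entry in row \<open>k - 1\<close> and
    column 0 is the cofactor at \<open>(0, k - 1)\<close>.\<close>
  then have "det S * y $ (k - 1) = complex_of_real (vnorm b) * cofactor S 0 (k - 1)"
    using k y S by (simp add: adj_mat_def)
  then have "(- 1) ^ k * (y $ (k - 1) * poly (char_poly T) z)
      = complex_of_real (vnorm b) * cofactor S 0 (k - 1)"
    unfolding S_def det_shift_mat[OF T_carrier] by (simp add: ac_simps)
  moreover have "(- 1) ^ k * (- 1) ^ k = (1 :: complex)"
    by (simp flip: power_mult_distrib)
  ultimately have "y $ (k - 1) * poly (char_poly T) z
      = (- 1) ^ k * (complex_of_real (vnorm b) * cofactor S 0 (k - 1))"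
    by (metis mult.assoc mult_1)
  then show "y $ (k - 1) * poly (char_poly T) z = (- 1) ^ k * (complex_of_real (vnorm b) *
      ((- 1) ^ (k - 1) * (\<Prod>i\<leftarrow>[0..<k - 1]. complex_of_real (\<beta> (Suc i)))))"
    unfolding S_def corner_cofactor .
qed

text \<open>Off the spectrum the inverse in \<open>lanczos_res\<close> exists, so \<open>y\<close>
  is the solution of the projected system and \<open>residual_eq\<close> applies.\<close>

lemma lanczos_res_eq:
  assumes w: "w \<notin> spectrum T"
  obtains y where "y \<in> carrier_vec k" "shift_mat T w *\<^sub>v y = mat_adjoint Q *\<^sub>v b"
    "lanczos_res A b k w = - (y $ (k - 1)) \<cdot>\<^sub>v qt k"
proof -
  define B where "B = the (mat_inverse (shift_mat T w))"
  have B: "B \<in> carrier_mat k k" and SB: "shift_mat T w * B = 1\<^sub>m k"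
    using mat_inverse_shift_mat[OF T_carrier w] by (auto simp: B_def)
  note Q' = mat_adjoint_carrier[OF Q_carrier] and ST = shift_mat_carrier[OF T_carrier, of w]
    and SA = shift_mat_carrier[OF A, of w]
  define c where "c = mat_adjoint Q *\<^sub>v b"
  have c: "c \<in> carrier_vec k" using Q' b by (simp add: c_def)
  define y where "y = B *\<^sub>v c"
  have y: "y \<in> carrier_vec k" using B c by (simp add: y_def)
  have eq: "shift_mat T w *\<^sub>v y = c"
    unfolding y_def using assoc_mult_mat_vec[OF ST B c] SB c by simp
  have "shift_mat A w * Q * B * mat_adjoint Q *\<^sub>v b = shift_mat A w *\<^sub>v (Q *\<^sub>v y)"
    using assoc_mult_mat_vec[OF mult_carrier_mat[OF mult_carrier_mat[OF SA Q_carrier] B] Q' b]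
      assoc_mult_mat_vec[OF mult_carrier_mat[OF SA Q_carrier] B c]
      assoc_mult_mat_vec[OF SA Q_carrier y]
    by (simp add: c_def y_def)
  then have "lanczos_res A b k w = b - shift_mat A w *\<^sub>v (Q *\<^sub>v y)"
    by (simp add: lanczos_res_def B_def)
  then show thesis
    using that[of y] y eq residual_eq[OF y, of w] by (simp add: c_def)
qed

text \<open>The pointwise bound on the Cauchy kernel of the error. The list \<open>t\<close> comes
  from a diagonalization and \<open>lam\<close> from the characteristic polynomial; their orders may
  differ, and they are related only through \<open>T\<close>.\<close>

lemma cauchy_transform_error:
  fixes w :: real
  assumes U: "U \<in> carrier_mat n n" "mat_adjoint U * U = 1\<^sub>m n" "U * mat_adjoint U = 1\<^sub>m n"
    and AU: "A = U * mat_diag n (\<lambda>i. complex_of_real (d i)) * mat_adjoint U"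
    and V: "V \<in> carrier_mat k k" "mat_adjoint V * V = 1\<^sub>m k" "V * mat_adjoint V = 1\<^sub>m k"
    and TV: "T = V * mat_diag k (\<lambda>i. complex_of_real (t i)) * mat_adjoint V"
    and z: "\<And>i. i < n \<Longrightarrow> complex_of_real (d i) \<noteq> z" "\<And>i. i < k \<Longrightarrow> complex_of_real (t i) \<noteq> z"
    and M: "\<And>i. i < n \<Longrightarrow> cmod (1 / (complex_of_real (d i) - z)) \<le> M"
    and w: "complex_of_real w \<notin> spectrum T"
    and lam: "char_poly T = (\<Prod>i=1..k. [:- complex_of_real (lam i), 1:])"
    and lam_z: "\<And>i. i \<in> {1..k} \<Longrightarrow> complex_of_real (lam i) \<noteq> z"
  defines "c \<equiv> mat_adjoint Q *\<^sub>v b"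
  shows "cmod ((U * mat_diag n (\<lambda>i. 1 / (complex_of_real (d i) - z)) * mat_adjoint U *\<^sub>v b) \<bullet>c b
      - (V * mat_diag k (\<lambda>i. 1 / (complex_of_real (t i) - z)) * mat_adjoint V *\<^sub>v c) \<bullet>c c)
    \<le> M * (\<Prod>i=1..k. cmod (complex_of_real (lam i) - w) / cmod (complex_of_real (lam i) - z))\<^sup>2
      * (vnorm (lanczos_res A b k w))\<^sup>2"
proof -
  define R where "R = U * mat_diag n (\<lambda>i. 1 / (complex_of_real (d i) - z)) * mat_adjoint U"
  define G where "G u = V * mat_diag k (\<lambda>i. 1 / (complex_of_real (t i) - u)) * mat_adjoint V" for u
  define r where "r = qt k"
  have r: "r \<in> carrier_vec n" unfolding r_def by (rule qt_carrier)
  note Q' = mat_adjoint_carrier[OF Q_carrier]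
  have c: "c \<in> carrier_vec k" using Q' b by (simp add: c_def)
  have R: "R \<in> carrier_mat n n"
    unfolding R_def using U(1) mat_adjoint_carrier[OF U(1)] mat_diag_dim by (meson mult_carrier_mat)
  have G: "G u \<in> carrier_mat k k" for u
    unfolding G_def using V(1) mat_adjoint_carrier[OF V(1)] mat_diag_dim by (meson mult_carrier_mat)
  have AR: "shift_mat A z * R = 1\<^sub>m n" "R * shift_mat A z = 1\<^sub>m n"
    unfolding R_def AU using unitary_diag_resolvent[OF U, of "\<lambda>i. complex_of_real (d i)" z] z by auto
  have TG: "shift_mat T u * G u = 1\<^sub>m k" if "\<And>i. i < k \<Longrightarrow> complex_of_real (t i) \<noteq> u" for u
    unfolding G_def TV using unitary_diag_resolvent(1)[OF V, of "\<lambda>i. complex_of_real (t i)" u] that by auto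
  have Tsolve: "shift_mat T u *\<^sub>v (G u *\<^sub>v c) = c" if "\<And>i. i < k \<Longrightarrow> complex_of_real (t i) \<noteq> u" for u
    using assoc_mult_mat_vec[OF shift_mat_carrier[OF T_carrier, of u] G[of u] c] TG[OF that] c by simp
  have z': "complex_of_real (t i) \<noteq> cnj z" if "i < k" for i
    using z(2)[OF that] by (metis complex_cnj_cnj complex_cnj_complex_of_real)
  \<comment> \<open>The second solution, at the conjugate shift, is there because the adjoint of
    \<open>A - z I\<close> is \<open>A - cnj z I\<close>.\<close>
  define y y' where "y = G z *\<^sub>v c" and "y' = G (cnj z) *\<^sub>v c"
  have y: "y \<in> carrier_vec k" "y' \<in> carrier_vec k" 
    unfolding y_def y'_def by (rule mult_mat_vec_carrier[OF G c])+
  have yz: "shift_mat T z *\<^sub>v y = c" "shift_mat T (cnj z) *\<^sub>v y' = c"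
    using Tsolve[of z] Tsolve[of "cnj z"] z(2) z' by (auto simp: y_def y'_def)
  have Qy: "Q *\<^sub>v y \<in> carrier_vec n" "Q *\<^sub>v y' \<in> carrier_vec n" using Q_carrier y by simp_all
  define \<rho> \<rho>' where "\<rho> = - (y $ (k - 1)) \<cdot>\<^sub>v r" and "\<rho>' = - (y' $ (k - 1)) \<cdot>\<^sub>v r"
  have \<rho>c: "\<rho> \<in> carrier_vec n" "\<rho>' \<in> carrier_vec n" using r by (simp_all add: \<rho>_def \<rho>'_def)
  have \<rho>: "b - shift_mat A z *\<^sub>v (Q *\<^sub>v y) = \<rho>" "b - shift_mat A (cnj z) *\<^sub>v (Q *\<^sub>v y') = \<rho>'"
    using residual_eq[OF y(1)] residual_eq[OF y(2)] yz by (simp_all add: c_def \<rho>_def \<rho>'_def r_def)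
  note SA = shift_mat_carrier[OF A]
  define x where "x = R *\<^sub>v b"
  have x: "x \<in> carrier_vec n" using R b by (simp add: x_def)
  \<comment> \<open>The error of the Galerkin approximation \<open>Q y\<close> to the solution
    \<open>x\<close> of the shifted system.\<close>
  define e where "e = x - Q *\<^sub>v y"
  have e: "e \<in> carrier_vec n" using x Qy by (simp add: e_def)
  have Ae: "shift_mat A z *\<^sub>v e = \<rho>"
    unfolding e_def mult_minus_distrib_mat_vec[OF SA x Qy(1)]
    using assoc_mult_mat_vec[OF SA R b, of z] AR b \<rho> by (simp add: x_def)
  have eR: "e = R *\<^sub>v \<rho>"
    using assoc_mult_mat_vec[OF R SA e, of z] AR e by (simp add: Ae)
  have SQy: "shift_mat A (cnj z) *\<^sub>v (Q *\<^sub>v y') \<in> carrier_vec n" using SA Qy by (meson mult_mat_vec_carrier)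
  \<comment> \<open>Splitting \<open>b\<close> by the system at \<open>cnj z\<close> makes it
    possible to test \<open>e\<close> against a residual instead of \<open>b\<close>.\<close>
  have b_split: "b = \<rho>' + shift_mat A (cnj z) *\<^sub>v (Q *\<^sub>v y')"
    unfolding \<rho>(2)[symmetric]
    by (rule eq_vecI) (use carrier_vecD[OF SQy] carrier_vecD[OF b] in
        \<open>simp_all del: index_mult_mat_vec dim_mult_mat_vec\<close>)
  have "r \<bullet>c (Q *\<^sub>v y') = (mat_adjoint Q *\<^sub>v r) \<bullet>c y'"
    using cscalar_prod_adjoint[OF Q' r y(2)] by simp
  also have "\<dots> = 0" using y by (simp add: r_def adjoint_Q_qt)
  finally have rQ: "r \<bullet>c (Q *\<^sub>v y') = 0" .
  \<comment> \<open>Moved to the other side, the shifted matrix becomes \<open>A - z I\<close> and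
    maps \<open>e\<close> to \<open>\<rho>\<close>, a multiple of \<open>r\<close> and hence
    orthogonal to the range of \<open>Q\<close>.\<close>
  have "e \<bullet>c (shift_mat A (cnj z) *\<^sub>v (Q *\<^sub>v y')) = (shift_mat A z *\<^sub>v e) \<bullet>c (Q *\<^sub>v y')"
    using cscalar_prod_adjoint[OF SA e Qy(2), of z] by (simp add: shift_mat_adjoint[OF A hermitian])
  also have "\<dots> = 0"
    unfolding Ae \<rho>_def using cscalar_prod_smult_left[OF r Qy(2)] rQ by simp
  finally have "e \<bullet>c b = e \<bullet>c \<rho>'"
    using cscalar_prod_add_right[OF \<rho>c(2) SQy e] b_split by simp
  \<comment> \<open>Both residuals are multiples of \<open>r\<close>, so only the quadratic form of
    the resolvent at \<open>r\<close> remains.\<close>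
  also have "\<dots> = - (y $ (k - 1)) * ((R *\<^sub>v r) \<bullet>c \<rho>')"
    unfolding eR \<rho>_def mult_mat_vec[OF R r]
    by (rule cscalar_prod_smult_left[OF _ \<rho>c(2)]) (use R r in simp)
  also have "(R *\<^sub>v r) \<bullet>c \<rho>' = - cnj (y' $ (k - 1)) * ((R *\<^sub>v r) \<bullet>c r)"
    unfolding \<rho>'_def using cscalar_prod_smult_right[OF r, of "R *\<^sub>v r" "- (y' $ (k - 1))"] R r by simp
  finally have "cmod (e \<bullet>c b) = cmod (y $ (k - 1)) * cmod (y' $ (k - 1)) * cmod ((R *\<^sub>v r) \<bullet>c r)"
    by (simp add: norm_mult)
  moreover have "cmod ((R *\<^sub>v r) \<bullet>c r) \<le> M * (vnorm r)\<^sup>2"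
    unfolding R_def by (rule unitary_diag_form_bound[OF U(1,3) r M])
  ultimately have bound: "cmod (e \<bullet>c b)
      \<le> cmod (y $ (k - 1)) * cmod (y' $ (k - 1)) * (M * (vnorm r)\<^sup>2)"
    by (simp add: mult_left_mono)
  obtain yw where yw: "yw \<in> carrier_vec k" "shift_mat T w *\<^sub>v yw = c"
    and res: "lanczos_res A b k w = - (yw $ (k - 1)) \<cdot>\<^sub>v r"
    using lanczos_res_eq[OF w] unfolding c_def r_def by metis
  obtain C where C: "\<And>y z. y \<in> carrier_vec k \<Longrightarrow> shift_mat T z *\<^sub>v y = c \<Longrightarrow>
      y $ (k - 1) * poly (char_poly T) z = C"
    using last_entry unfolding c_def by metis
  \<comment> \<open>\<open>P u\<close> is the modulus of the determinant of
    \<open>T - u I\<close>.\<close>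
  define P where "P u = (\<Prod>i=1..k. cmod (complex_of_real (lam i) - u))" for u
  have P: "cmod (poly (char_poly T) u) = P u" for u
    unfolding lam P_def poly_prod prod_norm[symmetric]
    by (rule prod.cong) (auto simp: norm_minus_commute)
  have Pz: "P z \<noteq> 0" using lam_z by (auto simp: P_def)
  \<comment> \<open>The roots \<open>lam i\<close> are real, so conjugating the shift does not
    change \<open>P\<close>. The last entries of \<open>y\<close> and \<open>y'\<close> thus have
    equal modulus, and the ratio appears squared.\<close>
  have "cmod (complex_of_real a - cnj z) = cmod (complex_of_real a - z)" for a
    by (metis complex_cnj_complex_of_real complex_cnj_diff complex_mod_cnj)
  then have Pcnj: "P (cnj z) = P z" by (simp add: P_def)
  have CP: "cmod (y $ (k - 1)) * P z = cmod C" "cmod (y' $ (k - 1)) * P z = cmod C"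
    "cmod (yw $ (k - 1)) * P w = cmod C"
    using C[OF y(1) yz(1)] C[OF y(2) yz(2)] C[OF yw] Pcnj by (metis P norm_mult)+
  have ratio: "(\<Prod>i=1..k. cmod (complex_of_real (lam i) - w) / cmod (complex_of_real (lam i) - z)) = P w / P z"
    by (simp add: P_def prod_dividef)
  have last: "cmod (y $ (k - 1)) = P w / P z * cmod (yw $ (k - 1))"
    "cmod (y' $ (k - 1)) = P w / P z * cmod (yw $ (k - 1))"
    using CP Pz by (simp_all add: field_simps)
  have "(R *\<^sub>v b) \<bullet>c b - (G z *\<^sub>v c) \<bullet>c c = e \<bullet>c b"
    unfolding e_def cscalar_prod_minus_left[OF x Qy(1) b]
    using cscalar_prod_adjoint[OF Q_carrier y(1) b] by (simp add: x_def y_def c_def)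
  with bound show ?thesis
    unfolding R_def[symmetric] G_def[symmetric] ratio res vnorm_smult last
    by (simp add: power2_eq_square ac_simps)
qed

end

section \<open>The error bound\<close>

text \<open>Away from the pole the extended division agrees with the real quotient, which is one of
  the values in the supremum.\<close>

lemma ratio_le_norm_hwz:
  assumes "x \<in> X" and "complex_of_real x \<noteq> z"
  shows "ennreal (cmod (complex_of_real x - w) / cmod (complex_of_real x - z)) \<le> norm_hwz w z X"
  unfolding norm_hwz_def using assms
  by (intro SUP_upper2[of x]) (auto simp: divide_ennreal)

lemma inverse_le_norm_hz:
  assumes "x \<in> X" and "complex_of_real x \<noteq> z"
  shows "ennreal (cmod (1 / (complex_of_real x - z))) \<le> norm_hz z X"
  unfolding norm_hz_def using assms
  by (intro SUP_upper2[of x]) (auto simp: divide_ennreal norm_divide simp flip: ennreal_1)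

theorem mainTheorem3:
  fixes A :: "complex mat" and b :: "complex vec" and n k m :: nat
    and f :: "complex \<Rightarrow> complex" and D :: "complex set"
    and \<Gamma> :: "nat \<Rightarrow> real \<Rightarrow> complex"
    and w :: real and S :: "nat \<Rightarrow> real set" and lam :: "nat \<Rightarrow> real"
  assumes A: "A \<in> carrier_mat n n" and hermitian: "mat_adjoint A = A"
    and b: "b \<in> carrier_vec n" and b_nz: "b \<noteq> 0\<^sub>v n"
    and k: "1 \<le> k"
    and no_breakdown: "\<forall>j\<in>{1..<k}. lanczos_beta A b j \<noteq> 0"
    and D: "open D" "spectrum A \<union> spectrum (lanczos_T A b k) \<subseteq> D"
    and f: "f analytic_on D"
    and \<Gamma>: "encloses_once_in D m \<Gamma> (spectrum A \<union> spectrum (lanczos_T A b k))"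
    and w: "complex_of_real w \<notin> spectrum (lanczos_T A b k) \<union> spectrum A"
    and lam: "char_poly (lanczos_T A b k) = (\<Prod>i=1..k. [:- complex_of_real (lam i), 1:])"
    and S0: "spectrum A \<subseteq> complex_of_real ` S 0"
    and Si: "\<forall>i\<in>{1..k}. lam i \<in> S i"
  shows "ennreal (cmod ((hermitian_fun f A *\<^sub>v b) \<bullet>c b - lan A b k f \<bullet>c b))
    \<le> (ennreal (1 / (2 * pi)) *
        (\<Sum>j<m. arclength_integral (\<Gamma> j) (\<lambda>z. ennreal (cmod (f z)) *
           (\<Prod>i=1..k. (norm_hwz (complex_of_real w) z (S i))\<^sup>2) * norm_hz z (S 0))))
      * ennreal ((vnorm (lanczos_res A b k (complex_of_real w)))\<^sup>2)"
proof -
  interpret lanczos_process A b n k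
    by unfold_locales (fact A hermitian b b_nz k no_breakdown)+
  obtain U d where U: "U \<in> carrier_mat n n" "mat_adjoint U * U = 1\<^sub>m n" "U * mat_adjoint U = 1\<^sub>m n"
    and AU: "A = U * mat_diag n (\<lambda>i. complex_of_real (d i)) * mat_adjoint U"
    using hermitian_spectral_decomposition[OF A hermitian] by blast
  obtain V t where V: "V \<in> carrier_mat k k" "mat_adjoint V * V = 1\<^sub>m k" "V * mat_adjoint V = 1\<^sub>m k"
    and TV: "T = V * mat_diag k (\<lambda>i. complex_of_real (t i)) * mat_adjoint V"
    using hermitian_spectral_decomposition[OF T_carrier T_hermitian] by blast
  have d: "complex_of_real (d i) \<in> spectrum A" if "i < n" for i
    using unitary_diag_spectrum[OF U(1,2) AU that] .
  have t: "complex_of_real (t i) \<in> spectrum T" if "i < k" for i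
    using unitary_diag_spectrum[OF V(1,2) TV that] .
  have lam_spec: "complex_of_real (lam i) \<in> spectrum T" if "i \<in> {1..k}" for i
    using that unfolding spectrum_root_char_poly[OF T_carrier] lam poly_prod
    by (auto simp: prod_zero_iff)
  have n: "0 < n" using b b_nz by (cases n) auto
  define E where "E = spectrum A \<union> spectrum T"
  note Q' = mat_adjoint_carrier[OF Q_carrier]
  define c where "c = mat_adjoint Q *\<^sub>v b"
  have c: "c \<in> carrier_vec k" using Q' b by (simp add: c_def)
  define \<mu> where "\<mu> i = complex_of_real ((cmod ((mat_adjoint U *\<^sub>v b) $ i))\<^sup>2)" for i
  define \<nu> where "\<nu> i = complex_of_real ((cmod ((mat_adjoint V *\<^sub>v c) $ i))\<^sup>2)" for i
  \<comment> \<open>A disjoint union joins the eigenvalues of \<open>A\<close> and of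
    \<open>T\<close> into one family of nodes, with negated weights for \<open>T\<close>, so that
    Cauchy's formula is applied to the error as a whole.\<close>
  define I where "I = {..<n} <+> {..<k}"
  define p where "p = case_sum (\<lambda>i. complex_of_real (d i)) (\<lambda>i. complex_of_real (t i))"
  define a where "a = case_sum \<mu> (\<lambda>i. - \<nu> i)"
  have I: "finite I" "p ` I \<subseteq> E" using d t by (auto simp: I_def p_def E_def)
  \<comment> \<open>Used twice: with \<open>g = f\<close> for the error itself and with
    \<open>g x = 1 / (x - z)\<close> for its kernel on the contour.\<close>
  have form: "(U * mat_diag n (\<lambda>i. g (complex_of_real (d i))) * mat_adjoint U *\<^sub>v b) \<bullet>c b
      - (V * mat_diag k (\<lambda>i. g (complex_of_real (t i))) * mat_adjoint V *\<^sub>v c) \<bullet>c c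
      = (\<Sum>i\<in>I. a i * g (p i))" for g
    unfolding unitary_diag_quadratic_form[OF U(1) b] unitary_diag_quadratic_form[OF V(1) c]
      \<mu>_def[symmetric] \<nu>_def[symmetric] I_def
    by (simp add: sum.Plus p_def a_def sum_negf mult.commute)
  define F where "F = hermitian_fun f T"
  have F_eq: "F = V * mat_diag k (\<lambda>i. f (complex_of_real (t i))) * mat_adjoint V"
    unfolding F_def by (rule hermitian_fun_eq[OF V TV])
  have F: "F \<in> carrier_mat k k"
    unfolding F_eq using V(1) mat_adjoint_carrier[OF V(1)] mat_diag_dim by (meson mult_carrier_mat)
  have "lan A b k f = Q *\<^sub>v (F *\<^sub>v c)"
    unfolding lan_def F_def[symmetric] c_def
    using assoc_mult_mat_vec[OF mult_carrier_mat[OF Q_carrier F] Q' b]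
      assoc_mult_mat_vec[OF Q_carrier F c] by (simp add: c_def)
  then have "lan A b k f \<bullet>c b = (F *\<^sub>v c) \<bullet>c c"
    using cscalar_prod_adjoint[OF Q_carrier mult_mat_vec_carrier[OF F c] b] by (simp add: c_def)
  then have err: "(hermitian_fun f A *\<^sub>v b) \<bullet>c b - lan A b k f \<bullet>c b = (\<Sum>i\<in>I. a i * f (p i))"
    using form[of f] by (simp add: hermitian_fun_eq[OF U AU] F_eq)
  define v where "v = (vnorm (lanczos_res A b k w))\<^sup>2"
  have v0: "0 \<le> v" by (simp add: v_def)
  define H where "H z = ennreal (cmod (f z)) * (\<Prod>i=1..k. (norm_hwz w z (S i))\<^sup>2) * norm_hz z (S 0)" for z
  have bound: "ennreal (cmod (f z) * cmod (\<Sum>i\<in>I. a i / (p i - z))) \<le> ennreal v * H z"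
    if z: "z \<notin> E" for z
  proof -
    have dz: "complex_of_real (d i) \<noteq> z" if "i < n" for i using d[OF that] z by (auto simp: E_def)
    have tz: "complex_of_real (t i) \<noteq> z" if "i < k" for i using t[OF that] z by (auto simp: E_def)
    have lz: "complex_of_real (lam i) \<noteq> z" if "i \<in> {1..k}" for i
      using lam_spec[OF that] z by (auto simp: E_def)
    \<comment> \<open>The maximum is attained at an eigenvalue of \<open>A\<close>, hence at a point
      of \<open>S 0\<close>, which bounds it by the sup norm. It exists because \<open>b\<close> is
      nonzero and so \<open>n\<close> is positive.\<close>
    define M where "M = Max ((\<lambda>i. cmod (1 / (complex_of_real (d i) - z))) ` {..<n})"
    have M: "cmod (1 / (complex_of_real (d i) - z)) \<le> M" if "i < n" for i
      unfolding M_def using that by (intro Max_ge) auto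
    have "M \<in> (\<lambda>i. cmod (1 / (complex_of_real (d i) - z))) ` {..<n}"
      unfolding M_def using n by (intro Max_in) auto
    then obtain i0 where i0: "i0 < n" and M_eq: "M = cmod (1 / (complex_of_real (d i0) - z))" by auto
    have M0: "0 \<le> M" by (simp add: M_eq)
    have "d i0 \<in> S 0" using d[OF i0] S0 by auto
    then have hz: "ennreal M \<le> norm_hz z (S 0)"
      unfolding M_eq using dz[OF i0] by (rule inverse_le_norm_hz)
    define \<rho> where "\<rho> i = cmod (complex_of_real (lam i) - w) / cmod (complex_of_real (lam i) - z)" for i
    have \<rho>0: "0 \<le> \<rho> i" for i by (simp add: \<rho>_def)
    have \<rho>: "ennreal (\<rho> i) \<le> norm_hwz w z (S i)" if "i \<in> {1..k}" for i
      unfolding \<rho>_def using Si lz that by (intro ratio_le_norm_hwz) auto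
    have "ennreal ((\<Prod>i=1..k. \<rho> i)\<^sup>2) = (\<Prod>i=1..k. (ennreal (\<rho> i))\<^sup>2)"
      using \<rho>0 by (simp add: prod_ennreal ennreal_power prod_power_distrib)
    also have "\<dots> \<le> (\<Prod>i=1..k. (norm_hwz w z (S i))\<^sup>2)"
      using \<rho> by (intro prod_mono_ennreal power_mono) auto
    finally have prod: "ennreal ((\<Prod>i=1..k. \<rho> i)\<^sup>2) \<le> \<dots>" .
    have "cmod (\<Sum>i\<in>I. a i / (p i - z)) \<le> M * (\<Prod>i=1..k. \<rho> i)\<^sup>2 * v"
      using cauchy_transform_error[OF U AU V TV dz tz M _ lam lz] w
        form[of "\<lambda>x. 1 / (x - z)"]
      by (simp add: c_def \<rho>_def v_def)
    then have "ennreal (cmod (f z) * cmod (\<Sum>i\<in>I. a i / (p i - z)))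
        \<le> ennreal (cmod (f z) * (M * (\<Prod>i=1..k. \<rho> i)\<^sup>2 * v))"
      by (intro ennreal_leI mult_left_mono) auto
    also have "\<dots> = ennreal v * (ennreal (cmod (f z)) * ennreal ((\<Prod>i=1..k. \<rho> i)\<^sup>2) * ennreal M)"
      using M0 v0 by (simp add: ennreal_mult ac_simps)
    also have "\<dots> \<le> ennreal v * H z"
      unfolding H_def using hz prod by (intro mult_left_mono mult_mono) auto
    finally show ?thesis .
  qed
  have "ennreal (cmod (\<Sum>i\<in>I. a i * f (p i)))
      \<le> ennreal (1 / (2 * pi)) * (\<Sum>j<m. arclength_integral (\<Gamma> j)
        (\<lambda>z. ennreal (cmod (f z) * cmod (\<Sum>i\<in>I. a i / (p i - z)))))"
    using cauchy_weighted_sum_bound[OF D(1) _ f _ I] D(2) \<Gamma> by (simp add: E_def)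
  \<comment> \<open>The contours avoid both spectra, so the pointwise bound holds along them; the
    finite constant \<open>v\<close> is then moved out of the integrals, where an inequality
    suffices.\<close>
  also have "\<dots> \<le> ennreal (1 / (2 * pi)) * (\<Sum>j<m. ennreal v * arclength_integral (\<Gamma> j) H)"
  proof (intro mult_left_mono sum_mono arclength_integral_le_mult)
    fix j z assume "j \<in> {..<m}" "z \<in> path_image (\<Gamma> j)"
    then have "z \<notin> E" using \<Gamma> by (auto simp: encloses_once_in_def E_def)
    then show "ennreal (cmod (f z) * cmod (\<Sum>i\<in>I. a i / (p i - z))) \<le> ennreal v * H z"
      by (rule bound)
  qed auto
  also have "\<dots> = (ennreal (1 / (2 * pi)) * (\<Sum>j<m. arclength_integral (\<Gamma> j) H)) * ennreal v"
    by (simp add: ac_simps flip: sum_distrib_left)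
  finally show ?thesis
    unfolding err H_def v_def .
qed

end
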